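(* Let $T=(V,E)$ be a finite tree with at least two vertices whose edges carry real (symmetric) positive definite $s\times s$ matrix weights. Let $L(T)$ be the Laplacian matrix of $T$ and let $\mu(T)$ be the first (smallest) non-zero eigenvalue of $L(T)$. Then $\kappa(T)\le\mu(T)$.
   Context: Laplacian: for a tree $T=(V,E)$ on $n$ vertices with $s\times s$ matrix edge weights $W(e)$, $L(T)=[l_{uv}]_{u,v\in V}$ is the $ns\times ns$ block matrix whose $s\times s$ blocks are: for $u\ne v$, $l_{uv}=-W(e)$ if $u,v$ are joined by the edge $e$, and $l_{uv}=\mathbf 0$ if $u,v$ are not adjacent; $l_{vv}$ is the sum of the weights of the edges incident with $v$. The eigenvalues of $L(T)$ are nonnegative and $L(T)$ has rank $(n-1)s$; with eigenvalues in increasing order $\lambda_1\le\dots\le\lambda_{ns}$, $\mu(T)=\lambda_{s+1}(L(T))$. For $v\in V$, $L_v$ is $L(T)$ with the row block and column block of $v$ deleted; it is invertible, and $M_v=L_v^{-1}$. A branch at $v$ is a connected component of the graph obtained from $T$ by deleting $v$ and its incident edges; $B_v(u)$ is the branch at $v$ containing $u$ ($u\neq v$). $M_v$ is block diagonal with one diagonal block $M_v(B)$ (bottleneck matrix) for each branch $B$ at $v$; for $x,y\in B$ the $(x,y)$ block of $M_v(B)$ is $\sum_{e\in \mathcal P(x,v)\cap\mathcal P(y,v)}W(e)^{-1}$, where $\mathcal P(a,b)$ is the path joining $a$ and $b$. Write $M_v(u)=M_v(B_v(u))$ and $\rho(\cdot)$ for spectral radius. A branch $B$ at $v$ is a Perron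 branch at $v$ if $\rho(M_v(B))=\rho(M_v)$, equivalently if $\rho(M_v(B))$ is the largest among all branches at $v$. One of two cases occurs: either there is a unique vertex $v$ with two or more Perron branches at $v$ (the characteristic-like vertex), or there is a unique pair of adjacent vertices $u\sim v$ such that $B_u(v)$ is the unique Perron branch at $u$ and $B_v(u)$ is the unique Perron branch at $v$ (the edge $e$ between $u$ and $v$ is the characteristic-like edge). The constant $\kappa(T)$: (a) if $T$ has a characteristic-like vertex $v$, then $\kappa(T)=1/\rho(M_v)$; (b) if $T$ has a characteristic-like edge $e$ between $u$ and $v$, then $$\kappa(T)=\frac{1}{\rho\big(M_u(v)-\nu(J\otimes W(e)^{-1})\big)}=\frac{1}{\rho\big(M_v(u)-(1-\nu)(J\otimes W(e)^{-1})\big)},$$ where $0<\nu<1$ is such that the two spectral radii are equal (such a $\nu$ exists). Here $J$ is the all-ones matrix of conformal order and $A\otimes B=[a_{ij}B]$ is the Kronecker product. *)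

theory Defs
  imports
    "Jordan_Normal_Form.Spectral_Radius"
    "Jordan_Normal_Form.Gauss_Jordan_Elimination"
    "Jordan_Normal_Form.DL_Submatrix"
begin

section \<open>Trees and branches\<close>

text \<open>
  A simple graph is a finite vertex set \<open>V\<close> with a set \<open>E\<close> of two-element subsets of \<open>V\<close>.
  The tree predicate of the entry Graph_Theory is not usable here: it counts \<open>u, v, u\<close> as a
  cycle of a symmetric digraph.
\<close>

definition simple_graph :: "'a set \<Rightarrow> 'a set set \<Rightarrow> bool" where
  "simple_graph V E \<longleftrightarrow> finite V \<and> (\<forall>e\<in>E. e \<subseteq> V \<and> card e = 2)"

definition adj_on :: "'a set set \<Rightarrow> 'a set \<Rightarrow> 'a rel" where
  "adj_on E S = {(x, y). x \<in> S \<and> y \<in> S \<and> {x, y} \<in> E}"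

definition graph_connected :: "'a set \<Rightarrow> 'a set set \<Rightarrow> bool" where
  "graph_connected V E \<longleftrightarrow> V \<noteq> {} \<and> (\<forall>x\<in>V. \<forall>y\<in>V. (x, y) \<in> (adj_on E V)\<^sup>*)"

definition graph_cycle :: "'a set set \<Rightarrow> 'a list \<Rightarrow> bool" where
  "graph_cycle E xs \<longleftrightarrow> 3 \<le> length xs \<and> distinct xs \<and>
     (\<forall>i < length xs. {xs ! i, xs ! (Suc i mod length xs)} \<in> E)"

definition tree :: "'a set \<Rightarrow> 'a set set \<Rightarrow> bool" where
  "tree V E \<longleftrightarrow> simple_graph V E \<and> graph_connected V E \<and> \<not> (\<exists>xs. graph_cycle E xs)"

text \<open>\<open>branch V E v u\<close> is the branch at \<open>v\<close> containing \<open>u\<close>, meant for \<open>u \<in> V - {v}\<close>.\<close>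

definition branch :: "'a set \<Rightarrow> 'a set set \<Rightarrow> 'a \<Rightarrow> 'a \<Rightarrow> 'a set" where
  "branch V E v u = {w \<in> V - {v}. (u, w) \<in> (adj_on E (V - {v}))\<^sup>*}"

definition branches :: "'a set \<Rightarrow> 'a set set \<Rightarrow> 'a \<Rightarrow> 'a set set" where
  "branches V E v = branch V E v ` (V - {v})"

section \<open>Matrices\<close>

definition sym_pos_def :: "nat \<Rightarrow> real mat \<Rightarrow> bool" where
  "sym_pos_def s A \<longleftrightarrow> A \<in> carrier_mat s s \<and> transpose_mat A = A \<and>
     (\<forall>x \<in> carrier_vec s. x \<noteq> 0\<^sub>v s \<longrightarrow> 0 < x \<bullet> (A *\<^sub>v x))"

text \<open>All real and complex eigenvalues count for the spectral radius of a real matrix.\<close>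

definition rho :: "real mat \<Rightarrow> real" where
  "rho A = spectral_radius (map_mat complex_of_real A)"

text \<open>Meant for invertible matrices only.\<close>

definition mat_inv :: "real mat \<Rightarrow> real mat" where
  "mat_inv A = the (mat_inverse A)"

definition kronecker :: "real mat \<Rightarrow> real mat \<Rightarrow> real mat" where
  "kronecker A B = mat (dim_row A * dim_row B) (dim_col A * dim_col B)
     (\<lambda>(i, j). A $$ (i div dim_row B, j div dim_col B) * B $$ (i mod dim_row B, j mod dim_col B))"

definition all_ones :: "nat \<Rightarrow> real mat" where
  "all_ones m = mat m m (\<lambda>_. 1)"

text \<open>
  Block matrices with \<open>s \<times> s\<close> blocks: the \<open>k\<close>-th row (column) block belongs to the vertex
  \<open>xs ! k\<close> of a list \<open>xs\<close> of distinct vertices.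
\<close>

definition block_matrix :: "nat \<Rightarrow> 'a list \<Rightarrow> ('a \<Rightarrow> 'a \<Rightarrow> real mat) \<Rightarrow> real mat" where
  "block_matrix s xs F = mat (length xs * s) (length xs * s)
     (\<lambda>(i, j). F (xs ! (i div s)) (xs ! (j div s)) $$ (i mod s, j mod s))"

definition principal_blocks :: "nat \<Rightarrow> 'a list \<Rightarrow> 'a set \<Rightarrow> real mat \<Rightarrow> real mat" where
  "principal_blocks s xs S A =
     (let I = {i. i < length xs * s \<and> xs ! (i div s) \<in> S} in submatrix A I I)"

section \<open>Laplacian and bottleneck matrices\<close>

text \<open>
  In the rest \<open>vs\<close> lists the vertices without repetition, so the vertex set is \<open>set vs\<close>; the
  order of the list only fixes the order of the row and column blocks.
\<close>

definition laplacian_block ::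
  "nat \<Rightarrow> 'a set set \<Rightarrow> ('a set \<Rightarrow> real mat) \<Rightarrow> 'a \<Rightarrow> 'a \<Rightarrow> real mat" where
  "laplacian_block s E W u v =
     (if u = v then mat s s (\<lambda>ij. \<Sum>e \<in> {e \<in> E. v \<in> e}. W e $$ ij)
      else if {u, v} \<in> E then - W {u, v}
      else 0\<^sub>m s s)"

definition laplacian ::
  "nat \<Rightarrow> 'a list \<Rightarrow> 'a set set \<Rightarrow> ('a set \<Rightarrow> real mat) \<Rightarrow> real mat" where
  "laplacian s vs E W = block_matrix s vs (laplacian_block s E W)"

definition mu :: "nat \<Rightarrow> 'a list \<Rightarrow> 'a set set \<Rightarrow> ('a set \<Rightarrow> real mat) \<Rightarrow> real" where
  "mu s vs E W = Min {k. eigenvalue (laplacian s vs E W) k \<and> k \<noteq> 0}"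

definition laplacian_del ::
  "nat \<Rightarrow> 'a list \<Rightarrow> 'a set set \<Rightarrow> ('a set \<Rightarrow> real mat) \<Rightarrow> 'a \<Rightarrow> real mat" where
  "laplacian_del s vs E W v = principal_blocks s vs (set vs - {v}) (laplacian s vs E W)"

definition M_mat ::
  "nat \<Rightarrow> 'a list \<Rightarrow> 'a set set \<Rightarrow> ('a set \<Rightarrow> real mat) \<Rightarrow> 'a \<Rightarrow> real mat" where
  "M_mat s vs E W v = mat_inv (laplacian_del s vs E W v)"

text \<open>
  The blocks of \<open>M_mat s vs E W v\<close> belong to the vertices in \<open>filter (\<lambda>w. w \<noteq> v) vs\<close>. The
  bottleneck matrix of a branch \<open>B\<close> at \<open>v\<close> is its diagonal block belonging to \<open>B\<close>.
\<close>

definition bottleneck ::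
  "nat \<Rightarrow> 'a list \<Rightarrow> 'a set set \<Rightarrow> ('a set \<Rightarrow> real mat) \<Rightarrow> 'a \<Rightarrow> 'a set \<Rightarrow> real mat" where
  "bottleneck s vs E W v B = principal_blocks s (filter (\<lambda>w. w \<noteq> v) vs) B (M_mat s vs E W v)"

section \<open>Perron branches and the constant \<open>\<kappa>\<close>\<close>

definition perron_branch ::
  "nat \<Rightarrow> 'a list \<Rightarrow> 'a set set \<Rightarrow> ('a set \<Rightarrow> real mat) \<Rightarrow> 'a \<Rightarrow> 'a set \<Rightarrow> bool" where
  "perron_branch s vs E W v B \<longleftrightarrow>
     B \<in> branches (set vs) E v \<and> rho (bottleneck s vs E W v B) = rho (M_mat s vs E W v)"

definition char_like_vertex ::
  "nat \<Rightarrow> 'a list \<Rightarrow> 'a set set \<Rightarrow> ('a set \<Rightarrow> real mat) \<Rightarrow> 'a \<Rightarrow> bool" where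
  "char_like_vertex s vs E W v \<longleftrightarrow> v \<in> set vs \<and>
     (\<exists>B C. B \<noteq> C \<and> perron_branch s vs E W v B \<and> perron_branch s vs E W v C)"

definition char_like_edge ::
  "nat \<Rightarrow> 'a list \<Rightarrow> 'a set set \<Rightarrow> ('a set \<Rightarrow> real mat) \<Rightarrow> 'a \<Rightarrow> 'a \<Rightarrow> bool" where
  "char_like_edge s vs E W u v \<longleftrightarrow> {u, v} \<in> E \<and>
     {B. perron_branch s vs E W u B} = {branch (set vs) E u v} \<and>
     {B. perron_branch s vs E W v B} = {branch (set vs) E v u}"

text \<open>For adjacent \<open>u\<close> and \<open>v\<close>, the matrix \<open>M\<^sub>u(v) - t (J \<otimes> W(e)\<^sup>-\<^sup>1)\<close> with \<open>e = {u, v}\<close>.\<close>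

definition split_bottleneck ::
  "nat \<Rightarrow> 'a list \<Rightarrow> 'a set set \<Rightarrow> ('a set \<Rightarrow> real mat) \<Rightarrow> 'a \<Rightarrow> 'a \<Rightarrow> real \<Rightarrow> real mat" where
  "split_bottleneck s vs E W u v t =
     (let B = branch (set vs) E u v in
      bottleneck s vs E W u B - t \<cdot>\<^sub>m kronecker (all_ones (card B)) (mat_inv (W {u, v})))"

text \<open>
  A tree has either exactly one characteristic-like vertex or exactly one characteristic-like
  edge. The value does not depend on the orientation of that edge, which
  exchanges \<open>\<nu>\<close> with \<open>1 - \<nu>\<close>, nor on the choice of \<open>\<nu>\<close>: in \<open>\<nu>\<close> the left spectral radius
  is nonincreasing and the right one nondecreasing.
\<close>

definition kappa :: "nat \<Rightarrow> 'a list \<Rightarrow> 'a set set \<Rightarrow> ('a set \<Rightarrow> real mat) \<Rightarrow> real" where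
  "kappa s vs E W =
     (if \<exists>v. char_like_vertex s vs E W v
      then 1 / rho (M_mat s vs E W (SOME v. char_like_vertex s vs E W v))
      else (let (u, v, \<nu>) = (SOME (u, v, \<nu>). char_like_edge s vs E W u v \<and> 0 < \<nu> \<and> \<nu> < 1 \<and>
                rho (split_bottleneck s vs E W u v \<nu>) = rho (split_bottleneck s vs E W v u (1 - \<nu>)))
            in 1 / rho (split_bottleneck s vs E W u v \<nu>)))"

end

theory Submission
  imports Defs "HOL-Analysis.Convex"
begin

text \<open>
  Let \<open>x\<close> be an eigenvector of the Laplacian \<open>L\<close> for an eigenvalue \<open>k \<noteq> 0\<close>. Since \<open>L\<close> is
  symmetric and kills the vectors that are constant along the vertices, the blocks of \<open>x\<close> add
  up to \<open>0\<close>. Hence subtracting one and the same block \<open>z\<close> everywhere does not change the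
  energy \<open>x \<cdot> L x\<close>, a sum over the edges \<open>{a, b}\<close> of terms that depend on \<open>x\<^sub>a - x\<^sub>b\<close>, and can only
  increase the norm. So \<open>\<kappa> \<le> k\<close> follows once some choice of \<open>z\<close> makes the energy of
  \<open>y = x - z\<close> at least \<open>\<kappa> |y|\<^sup>2\<close> (lemma \<open>le_mu_if_energy_bound\<close>).

  For a vertex \<open>v\<close> take \<open>z = x\<^sub>v\<close>. Then \<open>y\<close> vanishes at \<open>v\<close>, its energy is that of the reduced
  Laplacian \<open>L\<^sub>v\<close>, and \<open>L\<^sub>v\<close> has smallest eigenvalue \<open>1 / \<rho>(M\<^sub>v)\<close>
  (lemma \<open>vertex_bound\<close>).

  For an edge \<open>e\<close> between \<open>u\<close> and \<open>v\<close> take \<open>z = (1 - \<nu>) x\<^sub>u + \<nu> x\<^sub>v\<close>. This is the value that minimises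
  the energy at a new vertex subdividing \<open>e\<close> into parts of resistance \<open>\<nu> W(e)\<^sup>-\<^sup>1\<close> and
  \<open>(1 - \<nu>) W(e)\<^sup>-\<^sup>1\<close>, and the energy of \<open>x\<close> is the sum of the energies of the two
  halves, both grounded at the new vertex. The inverse of the grounded Laplacian on the side of
  \<open>v\<close> is \<open>M\<^sub>u(v) - \<nu> (J \<otimes> W(e)\<^sup>-\<^sup>1)\<close>, and on the side of \<open>u\<close> it is the matrix with the roles of the
  ends exchanged. When both have the spectral radius \<open>r\<close>, both halves have energy at least
  \<open>|y|\<^sup>2 / r\<close> on their part (lemmas \<open>half_edge_bound\<close> and \<open>edge_bound\<close>).

  Because \<open>\<kappa>\<close> is defined by choice, the edge and the parameter have to be shown to exist. If no
  vertex has two Perron branches, a vertex with the smallest Perron branch has a neighbour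
  whose Perron branch points back (lemma \<open>neighbouring_branches_point_at_each_other\<close>). The
  parameter comes from the intermediate value theorem: the spectral radius of a symmetric matrix
  is Lipschitz, and at the ends of \<open>[0, 1]\<close> the comparison of the two radii is settled by the
  uniqueness of the Perron branches (lemma \<open>rho_split_1_less\<close>).

  The blocks are handled through kernels, that is, matrices indexed by a list of distinct
  objects instead of numbers; quadratic forms are then sums over the set of these objects.
\<close>

unbundle no inner_syntax

section \<open>Matrices as kernels\<close>

definition kmat :: "'i list \<Rightarrow> ('i \<Rightarrow> 'i \<Rightarrow> real) \<Rightarrow> real mat" where
  "kmat ps K = mat (length ps) (length ps) (\<lambda>(i, j). K (ps ! i) (ps ! j))"

definition kvec :: "'i list \<Rightarrow> ('i \<Rightarrow> real) \<Rightarrow> real vec" where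
  "kvec ps f = vec (length ps) (\<lambda>i. f (ps ! i))"

definition form :: "'i set \<Rightarrow> ('i \<Rightarrow> 'i \<Rightarrow> real) \<Rightarrow> ('i \<Rightarrow> real) \<Rightarrow> ('i \<Rightarrow> real) \<Rightarrow> real" where
  "form X K f g = (\<Sum>p\<in>X. \<Sum>q\<in>X. f p * K p q * g q)"

lemma kmat_carrier [simp]: "kmat ps K \<in> carrier_mat (length ps) (length ps)"
  by (simp add: kmat_def)

lemma kvec_carrier [simp]: "kvec ps f \<in> carrier_vec (length ps)"
  by (simp add: kvec_def)

lemma sum_nth_distinct:
  assumes "distinct ps"
  shows "(\<Sum>i<length ps. h (ps ! i)) = (\<Sum>p\<in>set ps. h p)"
  using assms by (intro sum.reindex_bij_betw bij_betw_nth) auto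

lemma kmat_mult_kvec:
  assumes "distinct ps"
  shows "kmat ps K *\<^sub>v kvec ps f = kvec ps (\<lambda>p. \<Sum>q\<in>set ps. K p q * f q)"
  by (rule eq_vecI)
    (simp_all add: kmat_def kvec_def scalar_prod_def lessThan_atLeast0[symmetric]
      sum_nth_distinct[OF assms, of "\<lambda>q. K _ q * f q"])

lemma kmat_mult:
  assumes "distinct ps"
  shows "kmat ps K * kmat ps G = kmat ps (\<lambda>p r. \<Sum>q\<in>set ps. K p q * G q r)"
  by (rule eq_matI)
    (simp_all add: kmat_def scalar_prod_def lessThan_atLeast0[symmetric]
      sum_nth_distinct[OF assms, of "\<lambda>q. K _ q * G q _"])

lemma kvec_scalar_prod:
  assumes "distinct ps"
  shows "kvec ps f \<bullet> kvec ps g = (\<Sum>p\<in>set ps. f p * g p)"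
  by (simp add: kvec_def scalar_prod_def lessThan_atLeast0[symmetric]
      sum_nth_distinct[OF assms, of "\<lambda>q. f q * g q"])

lemma kvec_eq_iff:
  "kvec ps f = kvec ps g \<longleftrightarrow> (\<forall>p\<in>set ps. f p = g p)"
  unfolding kvec_def vec_eq_iff by (auto simp: in_set_conv_nth Ball_def)

lemma kmat_eq_iff:
  "kmat ps K = kmat ps G \<longleftrightarrow> (\<forall>p\<in>set ps. \<forall>q\<in>set ps. K p q = G p q)"
proof
  assume L: "kmat ps K = kmat ps G"
  show "\<forall>p\<in>set ps. \<forall>q\<in>set ps. K p q = G p q"
  proof (intro ballI)
    fix p q assume "p \<in> set ps" "q \<in> set ps"
    then obtain i j where "i < length ps" "p = ps ! i" "j < length ps" "q = ps ! j"
      by (auto simp: in_set_conv_nth)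
    then show "K p q = G p q"
      using arg_cong[OF L, of "\<lambda>A. A $$ (i, j)"] by (simp add: kmat_def)
  qed
qed (auto simp: kmat_def)

lemma kvec_zero_iff: "kvec ps f = 0\<^sub>v (length ps) \<longleftrightarrow> (\<forall>p\<in>set ps. f p = 0)"
  using kvec_eq_iff[of ps f "\<lambda>_. 0"] by (simp add: kvec_def zero_vec_def)

lemma kvec_surj:
  assumes "distinct ps" "x \<in> carrier_vec (length ps)"
  obtains f where "x = kvec ps f"
proof
  define f where "f p = x $ (THE i. i < length ps \<and> ps ! i = p)" for p
  have "(THE k. k < length ps \<and> ps ! k = ps ! i) = i" if "i < length ps" for i
    using that assms(1) by (auto simp: nth_eq_iff_index_eq)
  then show "x = kvec ps f"
    using assms(2) by (auto simp: kvec_def f_def)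
qed

lemma kmat_surj:
  assumes "distinct ps" "A \<in> carrier_mat (length ps) (length ps)"
  obtains K where "A = kmat ps K"
proof
  define n where "n p = (THE i. i < length ps \<and> ps ! i = p)" for p
  have "n (ps ! i) = i" if "i < length ps" for i
    using that assms(1) by (auto simp: nth_eq_iff_index_eq n_def)
  then show "A = kmat ps (\<lambda>p q. A $$ (n p, n q))"
    using assms(2) by (auto simp: kmat_def)
qed

lemma kmat_one: "distinct ps \<Longrightarrow> 1\<^sub>m (length ps) = kmat ps (\<lambda>p q. if p = q then 1 else 0)"
  by (rule eq_matI) (auto simp: kmat_def nth_eq_iff_index_eq)

text \<open>
  The list of indices is restricted in the same way as rows and columns, so that a principal
  submatrix of a kernel matrix keeps its kernel.
\<close>

lemma submatrix_kmat: "submatrix (kmat ps K) I I = kmat (nths ps I) K"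
proof -
  have eq: "{i. i < length ps \<and> i \<in> I} = {i \<in> I. i < length ps}" by auto
  show ?thesis
    unfolding submatrix_def kmat_def
    by (rule eq_matI)
      (auto simp: length_nths nth_nths pick_le eq)
qed

section \<open>Spectral radius of symmetric matrices\<close>

text \<open>
  Symmetry makes an eigenvalue \<open>k\<close> of largest modulus real: if \<open>a + \<i> b\<close> is an eigenvector, comparing
  \<open>a \<bullet> A b\<close> with \<open>A a \<bullet> b\<close> gives \<open>Im k (|a|\<^sup>2 + |b|\<^sup>2) = 0\<close>. Then \<open>a\<close> and \<open>b\<close> satisfy the eigenvalue
  equation separately, and one of them is nonzero.
\<close>

lemma sym_eigenvector_of_rho:
  assumes A: "A \<in> carrier_mat n n" and sym: "transpose_mat A = A" and n: "0 < n"
  obtains k x where "\<bar>k\<bar> = rho A" "eigenvector A x k"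
proof -
  let ?C = "map_mat complex_of_real A"
  have C: "?C \<in> carrier_mat n n" using A by simp
  obtain k where k: "k \<in> spectrum ?C" "rho A = norm k"
    using spectral_radius_mem_max(1)[OF C n] unfolding rho_def by auto
  then obtain z where z: "z \<in> carrier_vec n" "z \<noteq> 0\<^sub>v n" "?C *\<^sub>v z = k \<cdot>\<^sub>v z"
    using C unfolding spectrum_def eigenvalue_def eigenvector_def by auto
  define a where "a = map_vec Re z"
  define b where "b = map_vec Im z"
  have ab: "a \<in> carrier_vec n" "b \<in> carrier_vec n" using z by (auto simp: a_def b_def)
  have Ci: "(\<Sum>j = 0..<n. complex_of_real (A $$ (i, j)) * z $ j) = k * z $ i" if "i < n" for i
    using arg_cong[OF z(3), of "\<lambda>v. v $ i"] that z(1) A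
    by (auto simp: scalar_prod_def)
  have Aa: "A *\<^sub>v a = Re k \<cdot>\<^sub>v a - Im k \<cdot>\<^sub>v b"
  proof (rule eq_vecI)
    fix i assume "i < dim_vec (Re k \<cdot>\<^sub>v a - Im k \<cdot>\<^sub>v b)"
    then have i: "i < n" using ab by auto
    from arg_cong[OF Ci[OF i], of Re] show "(A *\<^sub>v a) $ i = (Re k \<cdot>\<^sub>v a - Im k \<cdot>\<^sub>v b) $ i"
      using i z(1) A by (auto simp: scalar_prod_def a_def b_def)
  qed (use A ab in auto)
  have Ab: "A *\<^sub>v b = Im k \<cdot>\<^sub>v a + Re k \<cdot>\<^sub>v b"
  proof (rule eq_vecI)
    fix i assume "i < dim_vec (Im k \<cdot>\<^sub>v a + Re k \<cdot>\<^sub>v b)"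
    then have i: "i < n" using ab by auto
    from arg_cong[OF Ci[OF i], of Im] show "(A *\<^sub>v b) $ i = (Im k \<cdot>\<^sub>v a + Re k \<cdot>\<^sub>v b) $ i"
      using i z(1) A by (auto simp: scalar_prod_def a_def b_def algebra_simps)
  qed (use A ab in auto)
  have "a \<bullet> (A *\<^sub>v b) = (A *\<^sub>v a) \<bullet> b"
    using transpose_vec_mult_scalar[OF A ab(2,1)] sym by simp
  then have "Im k * (a \<bullet> a) + Re k * (a \<bullet> b) = Re k * (a \<bullet> b) - Im k * (b \<bullet> b)"
    using ab by (simp add: Aa Ab scalar_prod_add_distrib[of _ n] minus_scalar_prod_distrib[of _ n])
  then have "Im k * (a \<bullet> a + b \<bullet> b) = 0" by (simp add: algebra_simps)
  moreover have "a \<noteq> 0\<^sub>v n \<or> b \<noteq> 0\<^sub>v n"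
  proof (rule ccontr)
    assume "\<not> ?thesis"
    then have 0: "a = 0\<^sub>v n" "b = 0\<^sub>v n" by auto
    have "z $ i = 0" if "i < n" for i
      using arg_cong[OF 0(1), of "\<lambda>v. v $ i"] arg_cong[OF 0(2), of "\<lambda>v. v $ i"] that z(1)
      by (simp add: a_def b_def complex_eq_iff)
    then have "z = 0\<^sub>v n" using z(1) by auto
    with z(2) show False by simp
  qed
  moreover have "0 \<le> a \<bullet> a" "0 \<le> b \<bullet> b" "a \<noteq> 0\<^sub>v n \<Longrightarrow> 0 < a \<bullet> a" "b \<noteq> 0\<^sub>v n \<Longrightarrow> 0 < b \<bullet> b"
    using ab conjugate_square_ge_0_vec[of a] conjugate_square_ge_0_vec[of b]
      conjugate_square_greater_0_vec[of a n] conjugate_square_greater_0_vec[of b n] by auto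
  ultimately have "Im k = 0" by (smt (verit) mult_eq_0_iff)
  then have "A *\<^sub>v a = Re k \<cdot>\<^sub>v a" "A *\<^sub>v b = Re k \<cdot>\<^sub>v b"
    using ab Aa Ab by auto
  moreover have "\<bar>Re k\<bar> = rho A"
    using k(2) \<open>Im k = 0\<close> by (simp add: cmod_eq_Re)
  ultimately show thesis
    using that \<open>a \<noteq> 0\<^sub>v n \<or> b \<noteq> 0\<^sub>v n\<close> ab A unfolding eigenvector_def by auto
qed

section \<open>Quadratic forms and the spectral radius\<close>

lemma form_diff_left: "form X K (\<lambda>p. f p - g p) h = form X K f h - form X K g h"
  by (simp add: form_def left_diff_distrib sum_subtractf)

lemma form_diff_right: "form X K h (\<lambda>p. f p - g p) = form X K h f - form X K h g"
  by (simp add: form_def right_diff_distrib sum_subtractf)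

lemma form_diff_scaled_kernel:
  "form X (\<lambda>p q. K p q - t * G p q) f g = form X K f g - t * form X G f g"
proof -
  have "f p * (K p q - t * G p q) * g q = f p * K p q * g q - t * (f p * G p q * g q)" for p q
    by (simp add: algebra_simps)
  then show ?thesis by (simp add: form_def sum_subtractf sum_distrib_left)
qed

lemma abs_eigenvalue_le_rho:
  assumes A: "A \<in> carrier_mat n n" and ev: "eigenvalue A k"
  shows "\<bar>k\<bar> \<le> rho A"
proof -
  have C: "map_mat complex_of_real A \<in> carrier_mat n n" using A by simp
  have "eigenvalue (map_mat complex_of_real A) (complex_of_real k)"
    using of_real_hom.eigenvalue_hom[OF A ev] .
  moreover have "0 < n"
    using eigenvalue_imp_nonzero_dim[OF A ev] .
  ultimately show ?thesis
    using spectral_radius_mem_max(2)[OF C _ imageI, of "complex_of_real k"]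
    by (simp add: rho_def spectrum_def)
qed

lemma rho_nonneg:
  assumes A: "A \<in> carrier_mat n n" and n: "0 < n"
  shows "0 \<le> rho A"
  using spectral_radius_mem_max(1)[of "map_mat complex_of_real A" n] A n
  unfolding rho_def by auto

lemma bounded_powers_of_rho_less_1:
  assumes A: "A \<in> carrier_mat n n" and r: "rho A < 1"
  obtains C where "\<And>k i j. i < n \<Longrightarrow> j < n \<Longrightarrow> \<bar>(A ^\<^sub>m k) $$ (i, j)\<bar> \<le> C"
proof -
  let ?C = "map_mat complex_of_real A"
  have "?C \<in> carrier_mat n n" using A by simp
  then obtain C where C: "norm_bound (?C ^\<^sub>m k) C" for k
    using spectral_radius_jnf_norm_bound_less_1_upper_triangular[of ?C n] r
    unfolding rho_def by blast
  have "\<bar>(A ^\<^sub>m k) $$ (i, j)\<bar> \<le> C" if "i < n" "j < n" for i j k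
  proof -
    have "?C ^\<^sub>m k = map_mat complex_of_real (A ^\<^sub>m k)"
      using of_real_hom.mat_hom_pow[OF A] by metis
    then show ?thesis
      using C[of k] that A pow_carrier_mat[OF A, of k] by (auto simp: norm_bound_def)
  qed
  then show thesis using that by blast
qed

text \<open>
  For symmetric \<open>A\<close> the numbers \<open>|A\<^sup>k f|\<^sup>2\<close> form a log-convex sequence by the Cauchy-Schwarz
  inequality. If it increased in its first step, it would grow geometrically, whereas the powers
  of a matrix of spectral radius below \<open>1\<close> are bounded. This replaces a diagonalisation of \<open>A\<close>.
\<close>

lemma rho_less_1_imp_contraction:
  assumes d: "distinct ps" and sym: "\<And>p q. p \<in> set ps \<Longrightarrow> q \<in> set ps \<Longrightarrow> K p q = K q p"
    and r: "rho (kmat ps K) < 1"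
  shows "(\<Sum>p\<in>set ps. (\<Sum>q\<in>set ps. K p q * f q)\<^sup>2) \<le> (\<Sum>p\<in>set ps. (f p)\<^sup>2)"
proof (rule ccontr)
  let ?A = "kmat ps K"
  let ?X = "set ps"
  define T where "T f = (\<lambda>p. \<Sum>q\<in>?X. K p q * f q)" for f :: "'a \<Rightarrow> real"
  define N where "N f = (\<Sum>p\<in>?X. (f p)\<^sup>2)" for f :: "'a \<Rightarrow> real"
  define a where "a k = N ((T ^^ k) f)" for k
  have adj: "(\<Sum>p\<in>?X. T f p * g p) = (\<Sum>p\<in>?X. f p * T g p)" for f g
  proof -
    have "(\<Sum>p\<in>?X. T f p * g p) = (\<Sum>p\<in>?X. \<Sum>q\<in>?X. K p q * f q * g p)"
      by (simp add: T_def sum_distrib_right)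
    also have "\<dots> = (\<Sum>q\<in>?X. \<Sum>p\<in>?X. K p q * f q * g p)" by (rule sum.swap)
    also have "\<dots> = (\<Sum>q\<in>?X. \<Sum>p\<in>?X. f q * (K q p * g p))"
      by (intro sum.cong refl) (simp add: sym)
    finally show ?thesis by (simp add: T_def sum_distrib_left)
  qed
  have N0: "0 \<le> N f" for f by (simp add: N_def sum_nonneg)
  have logconvex: "(a (Suc k))\<^sup>2 \<le> a k * a (Suc (Suc k))" for k
  proof -
    let ?g = "(T ^^ k) f"
    have "N (T ?g) = (\<Sum>p\<in>?X. ?g p * T (T ?g) p)"
      using adj[of ?g "T ?g"] by (simp add: N_def power2_eq_square)
    then show ?thesis
      using Cauchy_Schwarz_ineq_sum[of ?g "T (T ?g)" ?X]
      by (simp add: a_def N_def)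
  qed
  assume "\<not> ?thesis"
  then have gt: "a 0 < a 1" by (simp add: a_def N_def T_def)
  have a0: "0 < a 0"
    using logconvex[of 0] gt N0[of f] by (cases "a 0 = 0") (auto simp: a_def)
  \<comment> \<open>The growth factor \<open>q\<close> of the first step persists by log-convexity.\<close>
  define q where "q = a 1 / a 0"
  have q: "1 < q" using gt a0 by (simp add: q_def)
  have step: "0 < a k \<and> q * a k \<le> a (Suc k)" for k
  proof (induction k)
    case 0
    then show ?case using a0 by (simp add: q_def)
  next
    case (Suc k)
    then have p: "0 < a k" "q * a k \<le> a (Suc k)" by auto
    have p1: "0 < a (Suc k)" using p q mult_pos_pos[of q "a k"] by linarith
    have "q * a k * a (Suc k) \<le> a (Suc k) * a (Suc k)"
      using p p1 by (intro mult_right_mono) auto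
    also have "\<dots> \<le> a k * a (Suc (Suc k))"
      using logconvex[of k] by (simp add: power2_eq_square)
    finally have "a k * (q * a (Suc k)) \<le> a k * a (Suc (Suc k))" by (simp add: ac_simps)
    then show ?case using p p1 by simp
  qed
  have grow: "q ^ k * a 0 \<le> a k" for k
  proof (induction k)
    case (Suc k)
    then have "q * (q ^ k * a 0) \<le> q * a k" using q by (intro mult_left_mono) auto
    then show ?case using step[of k] by (simp add: mult.assoc)
  qed simp
  obtain C where C: "\<And>k i j. i < length ps \<Longrightarrow> j < length ps \<Longrightarrow> \<bar>(?A ^\<^sub>m k) $$ (i, j)\<bar> \<le> C"
    using bounded_powers_of_rho_less_1[OF kmat_carrier r] by blast
  have pow: "?A ^\<^sub>m k *\<^sub>v kvec ps f = kvec ps ((T ^^ k) f)" for k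
  proof (induction k arbitrary: f)
    case (Suc k)
    have "?A ^\<^sub>m Suc k *\<^sub>v kvec ps f = ?A ^\<^sub>m k *\<^sub>v (?A *\<^sub>v kvec ps f)"
      by (simp add: assoc_mult_mat_vec[of _ "length ps" "length ps" _ "length ps"] pow_carrier_mat)
    also have "\<dots> = ?A ^\<^sub>m k *\<^sub>v kvec ps (T f)"
      by (simp add: kmat_mult_kvec[OF d] T_def)
    finally show ?case using Suc by (simp add: funpow_swap1)
  next
    case 0
    have "dim_row ?A = length ps" by (simp add: kmat_def)
    then show ?case by simp
  qed
  \<comment> \<open>The entries of all powers are at most \<open>C\<close>, so the iterates are bounded by \<open>D\<close>.\<close>
  define D where "D = C * (\<Sum>i<length ps. \<bar>f (ps ! i)\<bar>)"
  have bound: "\<bar>(T ^^ k) f p\<bar> \<le> D" if "p \<in> ?X" for k p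
  proof -
    obtain i where i: "i < length ps" "p = ps ! i" using \<open>p \<in> ?X\<close> by (auto simp: in_set_conv_nth)
    have carr: "?A ^\<^sub>m k \<in> carrier_mat (length ps) (length ps)" by (simp add: pow_carrier_mat)
    note dims = carrier_matD[OF carr]
    have "(T ^^ k) f p = kvec ps ((T ^^ k) f) $ i" using i by (simp add: kvec_def)
    also have "\<dots> = (\<Sum>j<length ps. (?A ^\<^sub>m k) $$ (i, j) * f (ps ! j))"
      unfolding pow[symmetric] using i dims
      by (simp add: scalar_prod_def kvec_def lessThan_atLeast0)
    also have "\<bar>\<dots>\<bar> \<le> (\<Sum>j<length ps. C * \<bar>f (ps ! j)\<bar>)"
      by (rule order_trans[OF sum_abs], rule sum_mono)
        (auto simp: abs_mult intro!: mult_right_mono C i)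
    finally show ?thesis by (simp add: D_def sum_distrib_left)
  qed
  have "a k \<le> card ?X * D\<^sup>2" for k
    unfolding a_def N_def
    using sum_bounded_above[of ?X "\<lambda>p. ((T ^^ k) f p)\<^sup>2" "D\<^sup>2"] bound
    by (simp add: abs_le_square_iff[symmetric] order_trans[OF _ abs_ge_self])
  moreover obtain k where "card ?X * D\<^sup>2 / a 0 < q ^ k"
    using real_arch_pow[OF q] by blast
  then have "card ?X * D\<^sup>2 < q ^ k * a 0" using a0 by (simp add: field_simps)
  ultimately show False using grow[of k] by (meson not_less order_trans)
qed

lemma sym_kernel_eigenvector:
  assumes d: "distinct ps" and ne: "ps \<noteq> []"
    and sym: "\<And>p q. p \<in> set ps \<Longrightarrow> q \<in> set ps \<Longrightarrow> K p q = K q p"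
  obtains k f where "\<bar>k\<bar> = rho (kmat ps K)" "\<exists>p\<in>set ps. f p \<noteq> 0"
    "\<forall>p\<in>set ps. (\<Sum>q\<in>set ps. K p q * f q) = k * f p" "eigenvalue (kmat ps K) k"
proof -
  have "transpose_mat (kmat ps K) = kmat ps K"
    by (rule eq_matI) (auto simp: kmat_def sym)
  then obtain k x where k: "\<bar>k\<bar> = rho (kmat ps K)" and x: "eigenvector (kmat ps K) x k"
    using sym_eigenvector_of_rho[OF kmat_carrier] ne by blast
  obtain f where f: "x = kvec ps f"
    using kvec_surj[OF d] x by (metis eigenvector_def carrier_matD(1) kmat_carrier)
  have x': "kvec ps f \<noteq> 0\<^sub>v (length ps)" "kmat ps K *\<^sub>v kvec ps f = k \<cdot>\<^sub>v kvec ps f"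
    using x unfolding eigenvector_def f by (auto simp: kmat_def)
  have "k \<cdot>\<^sub>v kvec ps f = kvec ps (\<lambda>p. k * f p)" by (auto simp: kvec_def)
  with x'(2) have "\<forall>p\<in>set ps. (\<Sum>q\<in>set ps. K p q * f q) = k * f p"
    unfolding kmat_mult_kvec[OF d] by (simp add: kvec_eq_iff)
  moreover have "eigenvalue (kmat ps K) k" using x by (auto simp: eigenvalue_def)
  ultimately show thesis using that[of k f] k x'(1) by (simp add: kvec_zero_iff)
qed

lemma eigenvalue_kmat_iff:
  assumes d: "distinct ps"
  shows "eigenvalue (kmat ps K) k \<longleftrightarrow>
    (\<exists>f. (\<exists>p\<in>set ps. f p \<noteq> 0) \<and> (\<forall>p\<in>set ps. (\<Sum>q\<in>set ps. K p q * f q) = k * f p))"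
    (is "?L \<longleftrightarrow> (\<exists>f. ?P f)")
proof -
  have smult: "k \<cdot>\<^sub>v kvec ps f = kvec ps (\<lambda>p. k * f p)" for f by (auto simp: kvec_def)
  have *: "eigenvector (kmat ps K) (kvec ps f) k \<longleftrightarrow> ?P f" for f
    unfolding eigenvector_def kmat_mult_kvec[OF d] smult kvec_eq_iff
    by (simp add: kvec_zero_iff carrier_matD(1)[OF kmat_carrier])
  show ?thesis
  proof
    assume ?L
    then obtain x where x: "eigenvector (kmat ps K) x k" by (auto simp: eigenvalue_def)
    then obtain f where "x = kvec ps f"
      using kvec_surj[OF d] by (metis eigenvector_def carrier_matD(1) kmat_carrier)
    with x show "\<exists>f. ?P f" using * by auto
  next
    assume "\<exists>f. ?P f"
    then show ?L using * by (auto simp: eigenvalue_def)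
  qed
qed

lemma sum_sq_pos:
  fixes f :: "'i \<Rightarrow> real"
  assumes "finite X" "\<exists>p\<in>X. f p \<noteq> 0"
  shows "0 < (\<Sum>p\<in>X. (f p)\<^sup>2)"
  using assms by (auto simp: sum_nonneg_eq_0_iff less_le sum_nonneg)

lemma rho_attained:
  assumes d: "distinct ps" and ne: "ps \<noteq> []"
    and sym: "\<And>p q. p \<in> set ps \<Longrightarrow> q \<in> set ps \<Longrightarrow> K p q = K q p"
  obtains f where "0 < (\<Sum>p\<in>set ps. (f p)\<^sup>2)"
    "\<bar>form (set ps) K f f\<bar> = rho (kmat ps K) * (\<Sum>p\<in>set ps. (f p)\<^sup>2)"
proof -
  obtain k f where k: "\<bar>k\<bar> = rho (kmat ps K)" and f: "\<exists>p\<in>set ps. f p \<noteq> 0"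
    and ev: "\<forall>p\<in>set ps. (\<Sum>q\<in>set ps. K p q * f q) = k * f p"
    and "eigenvalue (kmat ps K) k"
    by (rule sym_kernel_eigenvector[OF d ne sym])
  have "form (set ps) K f f = (\<Sum>p\<in>set ps. f p * (\<Sum>q\<in>set ps. K p q * f q))"
    by (simp add: form_def sum_distrib_left mult.assoc)
  also have "\<dots> = (\<Sum>p\<in>set ps. f p * (k * f p))"
    using ev by (intro sum.cong) auto
  also have "\<dots> = k * (\<Sum>p\<in>set ps. (f p)\<^sup>2)"
    by (simp add: sum_distrib_left power2_eq_square mult.left_commute)
  finally have "\<bar>form (set ps) K f f\<bar> = rho (kmat ps K) * (\<Sum>p\<in>set ps. (f p)\<^sup>2)"
    by (simp add: abs_mult k sum_nonneg)
  then show thesis using that sum_sq_pos[of "set ps" f] f by auto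
qed

text \<open>
  The contraction property applied to \<open>K / c\<close> for every \<open>c\<close> above the spectral radius. Together with
  the preceding lemma this identifies the spectral radius of a symmetric kernel with the maximum
  of \<open>|f \<cdot> K f| / |f|\<^sup>2\<close>.
\<close>

lemma abs_form_le_rho:
  assumes d: "distinct ps" and ne: "ps \<noteq> []"
    and sym: "\<And>p q. p \<in> set ps \<Longrightarrow> q \<in> set ps \<Longrightarrow> K p q = K q p"
  shows "\<bar>form (set ps) K f f\<bar> \<le> rho (kmat ps K) * (\<Sum>p\<in>set ps. (f p)\<^sup>2)"
proof -
  let ?X = "set ps"
  let ?r = "rho (kmat ps K)"
  let ?N = "\<Sum>p\<in>?X. (f p)\<^sup>2"
  have r0: "0 \<le> ?r" using rho_nonneg[OF kmat_carrier] ne by auto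
  have "\<bar>form ?X K f f\<bar> \<le> c * ?N" if c: "?r < c" for c
  proof -
    let ?K = "\<lambda>p q. K p q / c"
    have c0: "0 < c" using c r0 by simp
    have symc: "?K p q = ?K q p" if "p \<in> ?X" "q \<in> ?X" for p q
      using sym[OF that] by simp
    obtain k g where k: "\<bar>k\<bar> = rho (kmat ps ?K)" and g: "\<exists>p\<in>?X. g p \<noteq> 0"
      and ev: "\<forall>p\<in>?X. (\<Sum>q\<in>?X. ?K p q * g q) = k * g p"
      and "eigenvalue (kmat ps ?K) k"
      by (rule sym_kernel_eigenvector[OF d ne symc])
    have "(\<Sum>q\<in>?X. K p q * g q) = (c * k) * g p" if "p \<in> ?X" for p
      using bspec[OF ev that] c0 by (simp add: sum_divide_distrib[symmetric] field_simps)
    then have "eigenvalue (kmat ps K) (c * k)"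
      using g eigenvalue_kmat_iff[OF d] by blast
    then have "c * \<bar>k\<bar> \<le> ?r"
      using abs_eigenvalue_le_rho[OF kmat_carrier] c0 by (metis abs_mult abs_of_pos)
    then have "rho (kmat ps ?K) < 1"
      using c c0 k by (metis mult.right_neutral mult_less_cancel_left_pos order.strict_trans1)
    then have le: "(\<Sum>p\<in>?X. (\<Sum>q\<in>?X. ?K p q * f q)\<^sup>2) \<le> ?N"
      by (intro rho_less_1_imp_contraction[OF d symc])
    have "form ?X K f f = c * (\<Sum>p\<in>?X. f p * (\<Sum>q\<in>?X. ?K p q * f q))"
      using c0 by (simp add: form_def sum_distrib_left field_simps)
    moreover have "\<bar>\<Sum>p\<in>?X. f p * (\<Sum>q\<in>?X. ?K p q * f q)\<bar> \<le> ?N"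
    proof -
      have N0: "0 \<le> ?N" by (simp add: sum_nonneg)
      have "(\<Sum>p\<in>?X. f p * (\<Sum>q\<in>?X. ?K p q * f q))\<^sup>2
          \<le> ?N * (\<Sum>p\<in>?X. (\<Sum>q\<in>?X. ?K p q * f q)\<^sup>2)"
        by (rule Cauchy_Schwarz_ineq_sum)
      also have "\<dots> \<le> ?N\<^sup>2"
        unfolding power2_eq_square[of ?N] by (rule mult_left_mono[OF le N0])
      finally show ?thesis
        unfolding abs_le_square_iff[symmetric] abs_of_nonneg[OF N0] .
    qed
    ultimately show ?thesis using c0 by (simp add: abs_mult)
  qed
  note * = this
  show ?thesis
  proof (cases "?N = 0")
    case True
    then show ?thesis using *[of "?r + 1"] by simp
  next
    case False
    then have N: "0 < ?N" by (simp add: less_le sum_nonneg)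
    have "\<bar>form ?X K f f\<bar> / ?N \<le> ?r"
      by (rule dense_ge) (use * N in \<open>simp add: field_simps\<close>)
    then show ?thesis using N by (simp add: field_simps)
  qed
qed

text \<open>
  The maximum of the absolute Rayleigh quotient is subadditive.
\<close>

lemma rho_triangle:
  assumes d: "distinct ps" and ne: "ps \<noteq> []"
    and symK: "\<And>p q. p \<in> set ps \<Longrightarrow> q \<in> set ps \<Longrightarrow> K p q = K q p"
    and symG: "\<And>p q. p \<in> set ps \<Longrightarrow> q \<in> set ps \<Longrightarrow> G p q = G q p"
  shows "rho (kmat ps (\<lambda>p q. K p q - t * G p q)) - rho (kmat ps (\<lambda>p q. K p q - t' * G p q))
    \<le> \<bar>t - t'\<bar> * rho (kmat ps G)"
proof -
  let ?X = "set ps"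
  let ?K = "\<lambda>t p q. K p q - t * G p q"
  have sym: "?K t p q = ?K t q p" if "p \<in> ?X" "q \<in> ?X" for p q t
    using symK[OF that] symG[OF that] by simp
  obtain f where f: "0 < (\<Sum>p\<in>?X. (f p)\<^sup>2)"
    "\<bar>form ?X (?K t) f f\<bar> = rho (kmat ps (?K t)) * (\<Sum>p\<in>?X. (f p)\<^sup>2)"
    by (rule rho_attained[OF d ne sym])
  have "form ?X (?K t) f f = form ?X (?K t') f f - (t - t') * form ?X G f f"
    by (simp add: form_diff_scaled_kernel left_diff_distrib)
  then have "\<bar>form ?X (?K t) f f\<bar> \<le> \<bar>form ?X (?K t') f f\<bar> + \<bar>t - t'\<bar> * \<bar>form ?X G f f\<bar>"
    using abs_triangle_ineq4[of "form ?X (?K t') f f" "(t - t') * form ?X G f f"]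
    by (simp add: abs_mult)
  also have "\<dots> \<le> rho (kmat ps (?K t')) * (\<Sum>p\<in>?X. (f p)\<^sup>2)
      + \<bar>t - t'\<bar> * (rho (kmat ps G) * (\<Sum>p\<in>?X. (f p)\<^sup>2))"
    by (intro add_mono mult_left_mono abs_form_le_rho[OF d ne] sym symG) auto
  finally have "rho (kmat ps (?K t)) * (\<Sum>p\<in>?X. (f p)\<^sup>2)
      \<le> (rho (kmat ps (?K t')) + \<bar>t - t'\<bar> * rho (kmat ps G)) * (\<Sum>p\<in>?X. (f p)\<^sup>2)"
    unfolding f(2) by (simp add: algebra_simps)
  then show ?thesis using f(1) by simp
qed

lemma isCont_rho_pencil:
  assumes d: "distinct ps" and ne: "ps \<noteq> []"
    and symK: "\<And>p q. p \<in> set ps \<Longrightarrow> q \<in> set ps \<Longrightarrow> K p q = K q p"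
    and symG: "\<And>p q. p \<in> set ps \<Longrightarrow> q \<in> set ps \<Longrightarrow> G p q = G q p"
  shows "isCont (\<lambda>t. rho (kmat ps (\<lambda>p q. K p q - t * G p q))) t"
    (is "isCont ?g t")
proof -
  let ?L = "rho (kmat ps G)"
  have L0: "0 \<le> ?L" using rho_nonneg[OF kmat_carrier] ne by auto
  have tri: "?g t - ?g t' \<le> \<bar>t - t'\<bar> * ?L" for t t'
    by (rule rho_triangle[where K = K and G = G, OF d ne]) (simp_all only: symK symG)
  have lip: "\<bar>?g t - ?g t'\<bar> \<le> ?L * \<bar>t - t'\<bar>" for t t'
    using tri[of t t'] tri[of t' t]
    by (simp add: abs_minus_commute[of t' t] mult.commute abs_le_iff)
  show ?thesis
    unfolding isCont_def LIM_eq
  proof (intro allI impI)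
    fix e :: real assume "0 < e"
    show "\<exists>d>0. \<forall>x. x \<noteq> t \<and> norm (x - t) < d \<longrightarrow> norm (?g x - ?g t) < e"
    proof (intro exI[of _ "e / (?L + 1)"] conjI allI impI)
      show "0 < e / (?L + 1)" using \<open>0 < e\<close> L0 by simp
      fix x assume "x \<noteq> t \<and> norm (x - t) < e / (?L + 1)"
      then have "\<bar>x - t\<bar> * (?L + 1) < e" using L0 by (simp add: field_simps)
      then have "?L * \<bar>x - t\<bar> < e" by (simp add: algebra_simps)
      then show "norm (?g x - ?g t) < e" using lip[of x t] by simp
    qed
  qed
qed

text \<open>
  With \<open>S = N\<^sup>-\<^sup>1\<close>, expanding the nonnegative form of \<open>N\<close> at \<open>y - S y / c\<close> gives
  \<open>y \<cdot> N y \<ge> 2 |y|\<^sup>2 / c - y \<cdot> S y / c\<^sup>2\<close>, and the last term is at most \<open>|y|\<^sup>2 / c\<close>.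
\<close>

lemma form_ge_of_inverse:
  assumes fin: "finite X" and symN: "\<And>p q. p \<in> X \<Longrightarrow> q \<in> X \<Longrightarrow> N p q = N q p"
    and inv: "\<And>p r. p \<in> X \<Longrightarrow> r \<in> X \<Longrightarrow> (\<Sum>q\<in>X. N p q * S q r) = (if p = r then 1 else 0)"
    and psd: "\<And>f. 0 \<le> form X N f f"
    and ub: "form X S y y \<le> c * (\<Sum>p\<in>X. (y p)\<^sup>2)" and c: "0 < c"
  shows "(\<Sum>p\<in>X. (y p)\<^sup>2) / c \<le> form X N y y"
proof -
  define z where "z q = (\<Sum>r\<in>X. S q r * y r) / c" for q
  have Nz: "(\<Sum>q\<in>X. N p q * z q) = y p / c" if p: "p \<in> X" for p
  proof -
    have "(\<Sum>q\<in>X. N p q * z q) = (\<Sum>q\<in>X. \<Sum>r\<in>X. N p q * S q r * y r) / c"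
      by (simp add: z_def sum_divide_distrib sum_distrib_left mult.assoc)
    also have "(\<Sum>q\<in>X. \<Sum>r\<in>X. N p q * S q r * y r) = (\<Sum>r\<in>X. (\<Sum>q\<in>X. N p q * S q r) * y r)"
      by (subst sum.swap) (simp add: sum_distrib_right)
    also have "\<dots> = (\<Sum>r\<in>X. if p = r then y r else 0)"
      by (intro sum.cong) (auto simp: inv p)
    finally show ?thesis using fin p by simp
  qed
  have f: "form X N g z = (\<Sum>p\<in>X. g p * y p) / c" for g
  proof -
    have "form X N g z = (\<Sum>p\<in>X. g p * (\<Sum>q\<in>X. N p q * z q))"
      by (simp add: form_def sum_distrib_left mult.assoc)
    also have "\<dots> = (\<Sum>p\<in>X. g p * (y p / c))" by (intro sum.cong) (auto simp: Nz)
    finally show ?thesis by (simp add: sum_divide_distrib)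
  qed
  have comm: "form X N z y = form X N y z"
    unfolding form_def by (subst sum.swap) (intro sum.cong refl, simp add: symN)
  have zz: "form X N z z = form X S y y / c\<^sup>2"
  proof -
    have "form X N z z = (\<Sum>p\<in>X. y p * (\<Sum>r\<in>X. S p r * y r)) / c\<^sup>2"
    proof -
      have "(\<Sum>p\<in>X. z p * y p) = (\<Sum>p\<in>X. y p * (\<Sum>r\<in>X. S p r * y r)) / c"
        unfolding sum_divide_distrib by (simp add: z_def mult.commute)
      then show ?thesis by (simp add: f power2_eq_square)
    qed
    then show ?thesis by (simp add: form_def sum_distrib_left mult.assoc)
  qed
  have "0 \<le> form X N (\<lambda>p. y p - z p) (\<lambda>p. y p - z p)" by (rule psd)
  also have "\<dots> = form X N y y - form X N y z - form X N z y + form X N z z"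
    by (simp add: form_diff_left form_diff_right)
  also have "\<dots> = form X N y y - 2 * (\<Sum>p\<in>X. (y p)\<^sup>2) / c + form X S y y / c\<^sup>2"
    unfolding comm zz by (simp add: f power2_eq_square)
  finally have "2 * (\<Sum>p\<in>X. (y p)\<^sup>2) / c \<le> form X N y y + form X S y y / c\<^sup>2" by simp
  moreover have "form X S y y / c\<^sup>2 \<le> (\<Sum>p\<in>X. (y p)\<^sup>2) / c"
    using ub c by (simp add: field_simps power2_eq_square)
  ultimately show ?thesis by linarith
qed

section \<open>Branches of a tree\<close>

lemma tree_edgeD:
  assumes "tree V E" "{x, y} \<in> E"
  shows "x \<in> V" "y \<in> V" "x \<noteq> y"
  using assms unfolding tree_def simple_graph_def by force+

lemma adj_on_rtrancl_sym: "(x, y) \<in> (adj_on E S)\<^sup>* \<Longrightarrow> (y, x) \<in> (adj_on E S)\<^sup>*"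
  by (rule symD[OF sym_rtrancl]) (auto simp: sym_def adj_on_def insert_commute)

lemma tree_induct:
  assumes t: "tree V E" and a: "a \<in> V" "P a" and x: "x \<in> V"
    and step: "\<And>x y. {x, y} \<in> E \<Longrightarrow> P x \<Longrightarrow> P y"
  shows "P x"
proof -
  have "(a, x) \<in> (adj_on E V)\<^sup>*"
    using t a x by (auto simp: tree_def graph_connected_def)
  then show ?thesis
    by (induction rule: rtrancl_induct) (use a step in \<open>auto simp: adj_on_def\<close>)
qed

lemma branch_subset: "branch V E v u \<subseteq> V - {v}"
  by (auto simp: branch_def)

lemma branch_self: "u \<in> V \<Longrightarrow> u \<noteq> v \<Longrightarrow> u \<in> branch V E v u"
  by (auto simp: branch_def)

lemma branch_eq:
  assumes "w \<in> branch V E v u"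
  shows "branch V E v w = branch V E v u"
  using assms adj_on_rtrancl_sym[of u w E "V - {v}"]
  by (auto simp: branch_def intro: rtrancl_trans)

lemma branch_closed:
  assumes t: "tree V E" and x: "x \<in> branch V E v u" and e: "{x, y} \<in> E" and y: "y \<noteq> v"
  shows "y \<in> branch V E v u"
proof -
  have "(x, y) \<in> adj_on E (V - {v})"
    using tree_edgeD[OF t e] branch_subset[of V E v u] x e y by (auto simp: adj_on_def)
  then show ?thesis
    using x tree_edgeD[OF t e] y by (auto simp: branch_def intro: rtrancl_into_rtrancl)
qed

lemma branches_disjoint:
  assumes "B \<in> branches V E v" "C \<in> branches V E v" "B \<noteq> C"
  shows "B \<inter> C = {}"
proof -
  obtain b c where "B = branch V E v b" "C = branch V E v c"
    using assms(1,2) by (auto simp: branches_def)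
  then show ?thesis
    using assms(3) branch_eq[of _ V E v b] branch_eq[of _ V E v c] by (metis disjoint_iff)
qed

lemma Union_branches: "\<Union> (branches V E v) = V - {v}"
  using branch_subset branch_self unfolding branches_def by fast

lemma rtrancl_distinct_path:
  assumes "(a, b) \<in> r\<^sup>*"
  shows "\<exists>xs. xs \<noteq> [] \<and> distinct xs \<and> hd xs = a \<and> last xs = b \<and>
    (\<forall>i. Suc i < length xs \<longrightarrow> (xs ! i, xs ! Suc i) \<in> r)"
  using assms
proof (induction rule: rtrancl_induct)
  case base
  show ?case by (rule exI[of _ "[a]"]) simp
next
  case (step y z)
  then obtain xs where xs: "xs \<noteq> []" "distinct xs" "hd xs = a" "last xs = y"
    and adj: "\<And>i. Suc i < length xs \<Longrightarrow> (xs ! i, xs ! Suc i) \<in> r" by blast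
  show ?case
  proof (cases "z \<in> set xs")
    case True
    then obtain k where k: "k < length xs" "z = xs ! k" by (auto simp: in_set_conv_nth)
    then have "last (take (Suc k) xs) = z" by (simp add: take_Suc_conv_app_nth)
    then show ?thesis
      using xs adj k by (intro exI[of _ "take (Suc k) xs"]) (auto simp: hd_take)
  next
    case False
    have "((xs @ [z]) ! i, (xs @ [z]) ! Suc i) \<in> r" if "Suc i < length (xs @ [z])" for i
    proof (cases "Suc i < length xs")
      case True
      then show ?thesis using adj by (simp add: nth_append)
    next
      case False
      with that have "i = length xs - 1" "Suc i = length xs" by auto
      then show ?thesis using xs(1,4) step(2) by (simp add: nth_append last_conv_nth)
    qed
    then show ?thesis using xs False by (intro exI[of _ "xs @ [z]"]) auto
  qed
qed

text \<open>
  A second vertex \<open>x\<close> of the branch adjacent to \<open>u\<close> would close a cycle: a path from \<open>v\<close> to \<open>x\<close> that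
  avoids \<open>u\<close>, followed by \<open>u\<close>.
\<close>

lemma branch_attached_by_one_edge:
  assumes t: "tree V E" and uv: "{u, v} \<in> E" and x: "x \<in> branch V E u v" and xu: "{x, u} \<in> E"
  shows "x = v"
proof (rule ccontr)
  assume "x \<noteq> v"
  let ?r = "adj_on E (V - {u})"
  obtain xs where xs: "xs \<noteq> []" "distinct xs" "hd xs = v" "last xs = x"
    and adj: "\<And>i. Suc i < length xs \<Longrightarrow> (xs ! i, xs ! Suc i) \<in> ?r"
    using rtrancl_distinct_path[of v x ?r] x by (auto simp: branch_def)
  have len: "2 \<le> length xs"
    using xs \<open>x \<noteq> v\<close> by (cases xs rule: remdups_adj.cases) auto
  have notin: "u \<notin> set xs"
  proof
    assume "u \<in> set xs"
    then obtain i where i: "i < length xs" "u = xs ! i" by (auto simp: in_set_conv_nth)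
    show False
    proof (cases i)
      case 0
      then show ?thesis using i xs tree_edgeD(3)[OF t uv] by (simp add: hd_conv_nth)
    next
      case (Suc j)
      then show ?thesis using adj[of j] i by (auto simp: adj_on_def)
    qed
  qed
  have "graph_cycle E (xs @ [u])"
    unfolding graph_cycle_def
  proof (intro conjI allI impI)
    show "3 \<le> length (xs @ [u])" "distinct (xs @ [u])" using len notin xs by auto
    fix i assume i: "i < length (xs @ [u])"
    show "{(xs @ [u]) ! i, (xs @ [u]) ! (Suc i mod length (xs @ [u]))} \<in> E"
    proof (cases "Suc i < length xs")
      case True
      then show ?thesis using adj[OF True] by (simp add: nth_append adj_on_def)
    next
      case False
      then consider "Suc i = length xs" | "i = length xs" using i by fastforce
      then show ?thesis
      proof cases
        case 1
        then have "xs ! i = x" using xs by (simp add: last_conv_nth flip: 1)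
        then show ?thesis using 1 xu by (simp add: nth_append flip: 1)
      next
        case 2
        have "xs ! 0 = v" using xs by (simp add: hd_conv_nth)
        then show ?thesis using 2 uv xs(1) by (simp add: nth_append)
      qed
    qed
  qed
  then show False using t by (auto simp: tree_def)
qed

text \<open>
  Walking from \<open>u\<close> without using \<open>v\<close> never enters the branch of \<open>v\<close>, since \<open>u\<close> is joined to it by
  one edge only; and by connectedness every vertex lies in one of the two branches.
\<close>

lemma edge_splits_tree:
  assumes t: "tree V E" and uv: "{u, v} \<in> E"
  shows "branch V E v u = V - branch V E u v"
proof -
  let ?B = "branch V E u v" and ?C = "branch V E v u"
  note e = tree_edgeD[OF t uv]
  have vB: "v \<in> ?B" and uC: "u \<in> ?C" using e by (auto intro: branch_self)
  have uB: "u \<notin> ?B" using branch_subset[of V E u v] by auto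
  have C_B: "w \<notin> ?B" if "(u, w) \<in> (adj_on E (V - {v}))\<^sup>*" for w
    using that
  proof (induction rule: rtrancl_induct)
    case (step y z)
    show ?case
    proof
      assume z: "z \<in> ?B"
      have zy: "{z, y} \<in> E" "z \<noteq> v" using step(2) by (auto simp: adj_on_def insert_commute)
      show False
      proof (cases "y = u")
        case True
        then show False using branch_attached_by_one_edge[OF t uv z] zy by auto
      next
        case False
        then show False using branch_closed[OF t z zy(1)] step.IH by auto
      qed
    qed
  qed (rule uB)
  have "w \<in> ?B \<or> w \<in> ?C" if "w \<in> V" for w
  proof (rule tree_induct[OF t e(1) _ that])
    fix x y assume xy: "{x, y} \<in> E" and "x \<in> ?B \<or> x \<in> ?C"
    then show "y \<in> ?B \<or> y \<in> ?C"
      using branch_closed[OF t _ xy, of u v] branch_closed[OF t _ xy, of v u] uC vB by auto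
  qed (use uC in auto)
  moreover have "?C \<subseteq> V - ?B" using C_B by (auto simp: branch_def)
  ultimately show ?thesis by auto
qed

lemma edge_leaving_branch:
  assumes t: "tree V E" and uv: "{u, v} \<in> E" and xy: "{x, y} \<in> E"
    and "x \<in> branch V E u v" "y \<notin> branch V E u v"
  shows "x = v \<and> y = u"
proof -
  have y: "y = u" using branch_closed[OF t assms(4) xy] assms(5) by auto
  then show ?thesis using branch_attached_by_one_edge[OF t uv assms(4)] xy by auto
qed

lemma branch_contains_neighbour:
  assumes t: "tree V E" and v: "v \<in> V" and B: "B \<in> branches V E v"
  obtains n where "{v, n} \<in> E" "B = branch V E v n"
proof -
  obtain u where u: "u \<in> V" "u \<noteq> v" "B = branch V E v u" using B by (auto simp: branches_def)
  have "u = v \<or> (\<exists>n. {v, n} \<in> E \<and> u \<in> branch V E v n)"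
  proof (rule tree_induct[OF t v _ u(1)])
    fix x y assume xy: "{x, y} \<in> E" and x: "x = v \<or> (\<exists>n. {v, n} \<in> E \<and> x \<in> branch V E v n)"
    show "y = v \<or> (\<exists>n. {v, n} \<in> E \<and> y \<in> branch V E v n)"
    proof (cases "x = v")
      case True
      then show ?thesis using xy tree_edgeD[OF t xy] branch_self[of y V v E] by auto
    next
      case False
      then show ?thesis using x branch_closed[OF t _ xy] by metis
    qed
  qed simp
  then show thesis using u branch_eq that by metis
qed

text \<open>
  Take \<open>v\<close> with \<open>P v\<close> of least size and let \<open>u\<close> be the neighbour of \<open>v\<close> in \<open>P v\<close>. If \<open>P u\<close> did not
  contain \<open>v\<close>, it would be a subset of \<open>P v\<close> that omits \<open>u\<close>.
\<close>

lemma neighbouring_branches_point_at_each_other: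
  assumes t: "tree V E" and ne: "V \<noteq> {}"
    and P: "\<And>v. v \<in> V \<Longrightarrow> P v \<in> branches V E v"
  obtains u v where "{u, v} \<in> E" "P u = branch V E u v" "P v = branch V E v u"
proof -
  have fin: "finite V" using t by (auto simp: tree_def simple_graph_def)
  obtain v where v: "v \<in> V" and min: "\<And>w. w \<in> V \<Longrightarrow> card (P v) \<le> card (P w)"
    using ex_has_least_nat[of "\<lambda>v. v \<in> V" _ "\<lambda>v. card (P v)"] ne by blast
  obtain u where vu: "{v, u} \<in> E" and Pv: "P v = branch V E v u"
    using branch_contains_neighbour[OF t v P[OF v]] .
  have uv: "{u, v} \<in> E" using vu by (simp add: insert_commute)
  note e = tree_edgeD[OF t uv]
  obtain a where ua: "{u, a} \<in> E" and Pu: "P u = branch V E u a"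
    using branch_contains_neighbour[OF t e(1) P[OF e(1)]] .
  have "a = v"
  proof (rule ccontr)
    assume "a \<noteq> v"
    then have "a \<notin> branch V E u v"
      using branch_attached_by_one_edge[OF t uv] ua by (auto simp: insert_commute)
    moreover have "a \<in> branch V E u a" using tree_edgeD[OF t ua] by (auto intro: branch_self)
    ultimately have "branch V E u a \<inter> branch V E u v = {}"
      using branch_eq[of _ V E u a] branch_eq[of _ V E u v] by (metis disjoint_iff)
    then have "P u \<subseteq> P v - {u}"
      using edge_splits_tree[OF t uv] branch_subset[of V E u a] unfolding Pu Pv by auto
    moreover have "u \<in> P v" unfolding Pv using e by (auto intro: branch_self)
    moreover have "finite (P v)" unfolding Pv by (rule finite_subset[OF branch_subset]) (use fin in simp)
    ultimately have "card (P u) < card (P v)" by (auto intro!: psubset_card_mono)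
    then show False using min[OF e(1)] by simp
  qed
  then show thesis using that uv Pu Pv by simp
qed

section \<open>Matrices of trees as kernels\<close>

lemma mat_inv_inverse:
  assumes A: "A \<in> carrier_mat n n"
    and inj: "\<And>x. x \<in> carrier_vec n \<Longrightarrow> A *\<^sub>v x = 0\<^sub>v n \<Longrightarrow> x = 0\<^sub>v n"
  shows "mat_inv A \<in> carrier_mat n n" "A * mat_inv A = 1\<^sub>m n" "mat_inv A * A = 1\<^sub>m n"
proof -
  have "det A \<noteq> 0" using inj det_0_iff_vec_prod_zero_field[OF A] by auto
  then have "A \<in> Units (ring_mat TYPE(real) n ())" by (rule det_non_zero_imp_unit[OF A])
  then obtain B where "mat_inverse A = Some B"
    using mat_inverse(1)[OF A, of "()"] by (cases "mat_inverse A") auto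
  then show "mat_inv A \<in> carrier_mat n n" "A * mat_inv A = 1\<^sub>m n" "mat_inv A * A = 1\<^sub>m n"
    using mat_inverse(2)[OF A] by (auto simp: mat_inv_def)
qed

lemma mat_inv_symmetric:
  assumes A: "A \<in> carrier_mat n n" and sym: "transpose_mat A = A"
    and inj: "\<And>x. x \<in> carrier_vec n \<Longrightarrow> A *\<^sub>v x = 0\<^sub>v n \<Longrightarrow> x = 0\<^sub>v n"
  shows "transpose_mat (mat_inv A) = mat_inv A"
proof -
  let ?B = "mat_inv A"
  note B = mat_inv_inverse[OF A inj]
  have BT: "transpose_mat ?B \<in> carrier_mat n n" using B by simp
  have "transpose_mat ?B * A = transpose_mat (A * ?B)"
    using sym transpose_mult[OF A B(1)] by simp
  then have 1: "transpose_mat ?B * A = 1\<^sub>m n" by (simp add: B)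
  have "transpose_mat ?B = transpose_mat ?B * (A * ?B)"
    using right_mult_one_mat[OF BT] by (simp add: B)
  also have "\<dots> = (transpose_mat ?B * A) * ?B"
    using assoc_mult_mat[OF BT A B(1)] by simp
  finally show ?thesis using B(1) by (simp add: 1)
qed

lemma kmat_inverse:
  assumes d: "distinct ps"
    and sym: "\<And>p q. p \<in> set ps \<Longrightarrow> q \<in> set ps \<Longrightarrow> K p q = K q p"
    and inj: "\<And>f. (\<And>p. p \<in> set ps \<Longrightarrow> (\<Sum>q\<in>set ps. K p q * f q) = 0) \<Longrightarrow> \<forall>p\<in>set ps. f p = 0"
  obtains G where "mat_inv (kmat ps K) = kmat ps G"
    "\<forall>p\<in>set ps. \<forall>r\<in>set ps. (\<Sum>q\<in>set ps. K p q * G q r) = (if p = r then 1 else 0)"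
    "\<forall>p\<in>set ps. \<forall>r\<in>set ps. (\<Sum>q\<in>set ps. G p q * K q r) = (if p = r then 1 else 0)"
    "\<forall>p\<in>set ps. \<forall>r\<in>set ps. G p r = G r p"
proof -
  let ?n = "length ps" and ?A = "kmat ps K"
  have A: "?A \<in> carrier_mat ?n ?n" by simp
  have symA: "transpose_mat ?A = ?A" by (rule eq_matI) (auto simp: kmat_def sym)
  have injA: "x = 0\<^sub>v ?n" if x: "x \<in> carrier_vec ?n" "?A *\<^sub>v x = 0\<^sub>v ?n" for x
  proof -
    obtain f where f: "x = kvec ps f" using kvec_surj[OF d x(1)] .
    have "\<forall>p\<in>set ps. (\<Sum>q\<in>set ps. K p q * f q) = 0"
      using x(2) unfolding f kmat_mult_kvec[OF d] kvec_zero_iff .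
    then show ?thesis unfolding f kvec_zero_iff using inj[of f] by blast
  qed
  note inv = mat_inv_inverse[OF A injA]
  obtain G where G: "mat_inv ?A = kmat ps G" using kmat_surj[OF d inv(1)] .
  have 1: "\<forall>p\<in>set ps. \<forall>r\<in>set ps. (\<Sum>q\<in>set ps. K p q * G q r) = (if p = r then 1 else 0)"
    using inv(2) unfolding G kmat_mult[OF d] kmat_one[OF d] kmat_eq_iff .
  have 2: "\<forall>p\<in>set ps. \<forall>r\<in>set ps. (\<Sum>q\<in>set ps. G p q * K q r) = (if p = r then 1 else 0)"
    using inv(3) unfolding G kmat_mult[OF d] kmat_one[OF d] kmat_eq_iff .
  have "transpose_mat (kmat ps G) = kmat ps (\<lambda>p r. G r p)"
    by (rule eq_matI) (auto simp: kmat_def)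
  then have 3: "\<forall>p\<in>set ps. \<forall>r\<in>set ps. G p r = G r p"
    using mat_inv_symmetric[OF A symA injA] unfolding G
    by (simp add: kmat_eq_iff)
  show thesis by (rule that[OF G 1 2 3])
qed

lemma block_matrix_kmat:
  "block_matrix s xs F = kmat (List.product xs [0..<s]) (\<lambda>p q. F (fst p) (fst q) $$ (snd p, snd q))"
proof (rule eq_matI)
  fix i j
  assume "i < dim_row (kmat (List.product xs [0..<s]) (\<lambda>p q. F (fst p) (fst q) $$ (snd p, snd q)))"
    and "j < dim_col (kmat (List.product xs [0..<s]) (\<lambda>p q. F (fst p) (fst q) $$ (snd p, snd q)))"
  then have ij: "i < length xs * s" "j < length xs * s" by (auto simp: kmat_def)
  then have "0 < s" by (cases s) auto
  then show "block_matrix s xs F $$ (i, j)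
      = kmat (List.product xs [0..<s]) (\<lambda>p q. F (fst p) (fst q) $$ (snd p, snd q)) $$ (i, j)"
    using ij by (simp add: block_matrix_def kmat_def product_nth)
qed (auto simp: block_matrix_def kmat_def)

lemma filter_product:
  "filter (\<lambda>p. fst p \<in> S) (List.product xs ys) = List.product (filter (\<lambda>x. x \<in> S) xs) ys"
  by (induction xs) (auto simp: filter_map o_def)

lemma principal_blocks_kmat:
  "principal_blocks s xs S (kmat (List.product xs [0..<s]) K)
    = kmat (List.product (filter (\<lambda>x. x \<in> S) xs) [0..<s]) K"
proof -
  let ?ps = "List.product xs [0..<s]"
  have "{i. i < length xs * s \<and> xs ! (i div s) \<in> S}
      = {i. i < length ?ps \<and> fst (?ps ! i) \<in> S}"
    by (auto simp: product_nth)
  then show ?thesis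
    unfolding principal_blocks_def Let_def submatrix_kmat
    by (simp only: filter_eq_nths[of "\<lambda>p. fst p \<in> S" ?ps, symmetric] filter_product)
qed

section \<open>The energy of a weighted tree\<close>

text \<open>
  Restricting a form to a subset of the indices is the same as extending vectors by zero; all
  passages between a tree and its parts use this.
\<close>

lemma form_restrict:
  assumes "finite Y" "X \<subseteq> Y"
    and f: "\<And>p. p \<in> Y \<Longrightarrow> f' p = (if p \<in> X then f p else 0)"
    and g: "\<And>p. p \<in> Y \<Longrightarrow> g' p = (if p \<in> X then g p else 0)"
  shows "form Y K f' g' = form X K f g"
proof -
  have "form Y K f' g' = (\<Sum>p\<in>X. \<Sum>q\<in>Y. f' p * K p q * g' q)"
    unfolding form_def using assms by (intro sum.mono_neutral_right) auto
  also have "\<dots> = (\<Sum>p\<in>X. \<Sum>q\<in>X. f' p * K p q * g' q)"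
    using assms by (intro sum.cong sum.mono_neutral_right) auto
  also have "\<dots> = form X K f g"
  proof -
    have "f' p = f p" "g' p = g p" if "p \<in> X" for p
      using that f[of p] g[of p] assms(2) by auto
    then show ?thesis unfolding form_def by (intro sum.cong refl) simp
  qed
  finally show ?thesis .
qed

lemma form_eq_sum_apply: "form X K f g = (\<Sum>p\<in>X. f p * (\<Sum>q\<in>X. K p q * g q))"
  by (simp add: form_def sum_distrib_left mult.assoc)

locale weighted_tree =
  fixes vs :: "'a list" and E :: "'a set set" and W :: "'a set \<Rightarrow> real mat" and s :: nat
  assumes tree: "tree (set vs) E" and distinct: "distinct vs" and s_pos: "0 < s"
    and two_vertices: "2 \<le> card (set vs)"
    and weights: "\<And>e. e \<in> E \<Longrightarrow> sym_pos_def s (W e)"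
begin

abbreviation V :: "'a set" where "V \<equiv> set vs"

abbreviation coords :: "'a set \<Rightarrow> ('a \<times> nat) set" where "coords S \<equiv> S \<times> {..<s}"

text \<open>
  The order of the list is the one of the row and column blocks in the definition of the
  Laplacian, its principal blocks and the bottleneck matrices.
\<close>

definition coord_list :: "'a set \<Rightarrow> ('a \<times> nat) list" where
  "coord_list S = List.product (filter (\<lambda>x. x \<in> S) vs) [0..<s]"

definition w :: "'a \<Rightarrow> 'a \<Rightarrow> nat \<Rightarrow> nat \<Rightarrow> real" where
  "w x y i j = (if {x, y} \<in> E then W {x, y} $$ (i, j) else 0)"

definition L :: "'a \<times> nat \<Rightarrow> 'a \<times> nat \<Rightarrow> real" where
  "L p q = laplacian_block s E W (fst p) (fst q) $$ (snd p, snd q)"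

lemma set_coord_list [simp]: "S \<subseteq> V \<Longrightarrow> set (coord_list S) = coords S"
  by (auto simp: coord_list_def)

lemma distinct_coord_list [simp]: "distinct (coord_list S)"
  by (simp add: coord_list_def distinct_product distinct)

lemma coord_list_ne: "S \<subseteq> V \<Longrightarrow> S \<noteq> {} \<Longrightarrow> coord_list S \<noteq> []"
  using s_pos set_coord_list[of S] by fastforce

lemma sum_coords: "(\<Sum>q\<in>coords S. h q) = (\<Sum>y\<in>S. \<Sum>j<s. h (y, j))"
  by (simp add: sum.cartesian_product)

lemmas edgeD = tree_edgeD[OF tree]

lemma weight_sym:
  assumes "{x, y} \<in> E" "i < s" "j < s"
  shows "W {x, y} $$ (i, j) = W {x, y} $$ (j, i)"
proof -
  have "W {x, y} \<in> carrier_mat s s" "transpose_mat (W {x, y}) = W {x, y}"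
    using weights[OF assms(1)] by (auto simp: sym_pos_def_def)
  then show ?thesis using assms(2,3) by (metis carrier_matD index_transpose_mat(1))
qed

lemma w_flip: "w x y = w y x"
  by (intro ext) (simp add: w_def insert_commute)

lemma w_sym: "i < s \<Longrightarrow> j < s \<Longrightarrow> w x y i j = w x y j i"
  by (simp add: w_def weight_sym)

lemma w_diag [simp]: "w x x i j = 0"
  using edgeD(3)[of x x] by (auto simp: w_def)

lemma L_diag:
  assumes x: "x \<in> V" and ij: "i < s" "j < s"
  shows "L (x, i) (x, j) = (\<Sum>z\<in>V. w x z i j)"
proof -
  have "bij_betw (\<lambda>z. {x, z}) {z \<in> V. {x, z} \<in> E} {e \<in> E. x \<in> e}"
    unfolding bij_betw_def
  proof
    show "inj_on (\<lambda>z. {x, z}) {z \<in> V. {x, z} \<in> E}"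
      by (rule inj_onI) (auto simp: doubleton_eq_iff)
    show "(\<lambda>z. {x, z}) ` {z \<in> V. {x, z} \<in> E} = {e \<in> E. x \<in> e}"
    proof (intro equalityI subsetI)
      fix e assume e: "e \<in> {e \<in> E. x \<in> e}"
      then have "e \<subseteq> V" "card e = 2" using tree by (auto simp: tree_def simple_graph_def)
      then obtain a b where "e = {a, b}" by (auto simp: card_2_iff)
      then show "e \<in> (\<lambda>z. {x, z}) ` {z \<in> V. {x, z} \<in> E}"
        using e \<open>e \<subseteq> V\<close> by (auto simp: insert_commute)
    qed auto
  qed
  then have "(\<Sum>e\<in>{e \<in> E. x \<in> e}. W e $$ (i, j)) = (\<Sum>z\<in>{z \<in> V. {x, z} \<in> E}. W {x, z} $$ (i, j))"
    by (rule sum.reindex_bij_betw[symmetric])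
  also have "\<dots> = (\<Sum>z\<in>V. w x z i j)"
    by (simp add: sum.inter_filter w_def)
  finally show ?thesis using ij by (simp add: L_def laplacian_block_def)
qed

lemma L_offdiag:
  assumes "x \<noteq> y" "i < s" "j < s"
  shows "L (x, i) (y, j) = - w x y i j"
proof (cases "{x, y} \<in> E")
  case True
  then have "W {x, y} \<in> carrier_mat s s" using weights by (auto simp: sym_pos_def_def)
  then show ?thesis using assms True by (auto simp: L_def laplacian_block_def w_def)
next
  case False
  then show ?thesis using assms by (simp add: L_def laplacian_block_def w_def)
qed

lemma L_sym: "p \<in> coords V \<Longrightarrow> q \<in> coords V \<Longrightarrow> L p q = L q p"
proof -
  assume pq: "p \<in> coords V" "q \<in> coords V"
  obtain x i y j where [simp]: "p = (x, i)" "q = (y, j)" by (cases p, cases q)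
  show ?thesis
  proof (cases "x = y")
    case True
    then show ?thesis using pq by (auto simp: L_diag w_sym intro: sum.cong)
  next
    case False
    then show ?thesis using pq w_sym[of i j x y] by (simp add: L_offdiag w_flip[of y x])
  qed
qed

lemma L_apply:
  assumes x: "x \<in> V" and i: "i < s"
  shows "(\<Sum>q\<in>coords V. L (x, i) q * f q) = (\<Sum>y\<in>V. \<Sum>j<s. w x y i j * (f (x, j) - f (y, j)))"
proof -
  have L: "L (x, i) (y, j) = (if y = x then \<Sum>z\<in>V. w x z i j else 0) - w x y i j" if "j < s" for y j
    using that x i by (auto simp: L_diag L_offdiag)
  have "(\<Sum>q\<in>coords V. L (x, i) q * f q)
      = (\<Sum>y\<in>V. \<Sum>j<s. (if y = x then \<Sum>z\<in>V. w x z i j else 0) * f (y, j) - w x y i j * f (y, j))"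
    unfolding sum_coords by (intro sum.cong refl) (simp add: L left_diff_distrib)
  also have "\<dots> = (\<Sum>j<s. \<Sum>y\<in>V. (if y = x then \<Sum>z\<in>V. w x z i j else 0) * f (y, j))
      - (\<Sum>y\<in>V. \<Sum>j<s. w x y i j * f (y, j))"
    by (simp only: sum_subtractf
        sum.swap[of "\<lambda>y j. (if y = x then \<Sum>z\<in>V. w x z i j else 0) * f (y, j)" "{..<s}" V])
  also have "(\<Sum>j<s. \<Sum>y\<in>V. (if y = x then \<Sum>z\<in>V. w x z i j else 0) * f (y, j))
      = (\<Sum>j<s. \<Sum>y\<in>V. if y = x then (\<Sum>z\<in>V. w x z i j) * f (x, j) else 0)"
    by (intro sum.cong) auto
  also have "\<dots> = (\<Sum>j<s. (\<Sum>z\<in>V. w x z i j) * f (x, j))"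
    using x by simp
  also have "\<dots> = (\<Sum>y\<in>V. \<Sum>j<s. w x y i j * f (x, j))"
    by (subst sum.swap) (simp add: sum_distrib_right)
  finally show ?thesis by (simp add: right_diff_distrib sum_subtractf)
qed

lemma L_apply_part:
  assumes S: "S \<subseteq> V" and x: "x \<in> V" and i: "i < s"
  shows "(\<Sum>q\<in>coords S. L (x, i) q * f q) =
    (\<Sum>y\<in>V. \<Sum>j<s. w x y i j * ((if x \<in> S then f (x, j) else 0) - (if y \<in> S then f (y, j) else 0)))"
proof -
  have "(\<Sum>q\<in>coords S. L (x, i) q * f q) = (\<Sum>q\<in>coords V. L (x, i) q * (if fst q \<in> S then f q else 0))"
    using S by (intro sum.mono_neutral_cong_left) auto
  also have "\<dots> = (\<Sum>y\<in>V. \<Sum>j<s. w x y i j * ((if x \<in> S then f (x, j) else 0) - (if y \<in> S then f (y, j) else 0)))"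
    unfolding L_apply[OF x i] by simp
  finally show ?thesis .
qed

text \<open>
  The factor \<open>2\<close> is there because every edge occurs in the double sum in both directions.
\<close>

lemma form_L_energy:
  "2 * form (coords V) L f f =
    (\<Sum>x\<in>V. \<Sum>y\<in>V. \<Sum>i<s. \<Sum>j<s. (f (x, i) - f (y, i)) * w x y i j * (f (x, j) - f (y, j)))"
proof -
  define T where "T x y = (\<Sum>i<s. \<Sum>j<s. f (x, i) * w x y i j * (f (x, j) - f (y, j)))" for x y
  have "form (coords V) L f f
      = (\<Sum>x\<in>V. \<Sum>i<s. f (x, i) * (\<Sum>y\<in>V. \<Sum>j<s. w x y i j * (f (x, j) - f (y, j))))"
    unfolding form_eq_sum_apply sum_coords[of _ V]
    by (intro sum.cong refl) (simp add: L_apply[unfolded sum_coords])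
  also have "\<dots> = (\<Sum>x\<in>V. \<Sum>i<s. \<Sum>y\<in>V. \<Sum>j<s. f (x, i) * w x y i j * (f (x, j) - f (y, j)))"
    by (simp add: sum_distrib_left mult.assoc)
  also have "\<dots> = (\<Sum>x\<in>V. \<Sum>y\<in>V. T x y)"
    unfolding T_def by (intro sum.cong refl sum.swap)
  finally have 1: "form (coords V) L f f = (\<Sum>x\<in>V. \<Sum>y\<in>V. T x y)" .
  then have 2: "form (coords V) L f f = (\<Sum>x\<in>V. \<Sum>y\<in>V. T y x)"
    by (subst sum.swap)
  have "T x y + T y x
      = (\<Sum>i<s. \<Sum>j<s. (f (x, i) - f (y, i)) * w x y i j * (f (x, j) - f (y, j)))" for x y
    unfolding T_def w_flip[of y x] sum.distrib[symmetric]
    by (intro sum.cong refl) (simp add: algebra_simps)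
  moreover have "2 * form (coords V) L f f = (\<Sum>x\<in>V. \<Sum>y\<in>V. T x y + T y x)"
    unfolding sum.distrib using 1 2 by linarith
  ultimately show ?thesis by simp
qed

lemma weight_form_pos:
  assumes e: "{x, y} \<in> E" and d: "\<exists>i<s. d i \<noteq> 0"
  shows "0 < (\<Sum>i<s. \<Sum>j<s. d i * w x y i j * d j)"
proof -
  let ?W = "W {x, y}" and ?d = "vec s d"
  have W: "?W \<in> carrier_mat s s" "\<And>x. x \<in> carrier_vec s \<Longrightarrow> x \<noteq> 0\<^sub>v s \<Longrightarrow> 0 < x \<bullet> (?W *\<^sub>v x)"
    using weights[OF e] by (auto simp: sym_pos_def_def)
  have "?d \<noteq> 0\<^sub>v s" using d by (auto simp: vec_eq_iff)
  then have "0 < ?d \<bullet> (?W *\<^sub>v ?d)" using W(2)[of ?d] by simp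
  also have "?d \<bullet> (?W *\<^sub>v ?d) = (\<Sum>i<s. \<Sum>j<s. d i * w x y i j * d j)"
    using W(1) e by (simp add: scalar_prod_def w_def lessThan_atLeast0 sum_distrib_left mult.assoc)
  finally show ?thesis .
qed

lemma weight_form_nonneg: "0 \<le> (\<Sum>i<s. \<Sum>j<s. d i * w x y i j * d j)"
proof (cases "{x, y} \<in> E \<and> (\<exists>i<s. d i \<noteq> 0)")
  case True
  then show ?thesis using weight_form_pos[of x y d] by auto
next
  case False
  then show ?thesis by (auto simp: w_def)
qed

lemma form_L_nonneg: "0 \<le> form (coords V) L f f"
proof -
  have "0 \<le> 2 * form (coords V) L f f"
    unfolding form_L_energy
    by (intro sum_nonneg weight_form_nonneg[of "\<lambda>i. f (x, i) - f (y, i)" for x y])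
  then show ?thesis by simp
qed

lemma form_L_zero:
  assumes z: "form (coords V) L f f = 0" and e: "{x, y} \<in> E" and i: "i < s"
  shows "f (x, i) = f (y, i)"
proof (rule ccontr)
  let ?q = "\<lambda>x y. \<Sum>i<s. \<Sum>j<s. (f (x, i) - f (y, i)) * w x y i j * (f (x, j) - f (y, j))"
  assume "f (x, i) \<noteq> f (y, i)"
  then have pos: "0 < ?q x y"
    using i by (intro weight_form_pos[OF e]) auto
  have nn: "0 \<le> ?q a b" for a b by (rule weight_form_nonneg)
  have "(\<Sum>a\<in>V. \<Sum>b\<in>V. ?q a b) = 0" using form_L_energy[of f] z by simp
  then have "\<forall>a\<in>V. (\<Sum>b\<in>V. ?q a b) = 0"
    by (subst (asm) sum_nonneg_eq_0_iff) (auto intro!: sum_nonneg nn)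
  then have "(\<Sum>b\<in>V. ?q x b) = 0" using edgeD(1)[OF e] by blast
  then have "\<forall>b\<in>V. ?q x b = 0"
    by (subst (asm) sum_nonneg_eq_0_iff) (auto intro!: nn)
  then show False using edgeD(2)[OF e] pos by auto
qed

lemma form_L_part:
  assumes "S \<subseteq> V"
  shows "form (coords S) L f f
    = form (coords V) L (\<lambda>p. if fst p \<in> S then f p else 0) (\<lambda>p. if fst p \<in> S then f p else 0)"
  by (rule form_restrict[symmetric]) (use assms in auto)

lemma form_L_part_nonneg: "S \<subseteq> V \<Longrightarrow> 0 \<le> form (coords S) L f f"
  by (subst form_L_part) (simp_all add: form_L_nonneg)

text \<open>
  A vector of energy \<open>0\<close> is constant along all edges, hence on the tree, and it vanishes at a
  vertex outside \<open>S\<close>.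
\<close>

lemma form_L_definite:
  assumes S: "S \<subset> V" and z: "form (coords S) L f f = 0" and p: "p \<in> coords S"
  shows "f p = 0"
proof -
  obtain a where a: "a \<in> V" "a \<notin> S" using S by blast
  obtain x i where p': "p = (x, i)" "x \<in> S" "i < s" using p by auto
  let ?f = "\<lambda>p. if fst p \<in> S then f p else 0"
  have z': "form (coords V) L ?f ?f = 0" using z form_L_part[of S] S by auto
  have "?f (x, i) = 0"
  proof (rule tree_induct[OF tree a(1)])
    show "?f (a, i) = 0" using a by simp
    show "x \<in> V" using p' S by auto
    show "?f (y, i) = 0" if "{x, y} \<in> E" "?f (x, i) = 0" for x y
      using form_L_zero[OF z' that(1) p'(3)] that(2) by simp
  qed
  then show ?thesis using p' by simp
qed

lemma form_L_shift:
  "form (coords V) L (\<lambda>p. f p - c (snd p)) (\<lambda>p. f p - c (snd p)) = form (coords V) L f f"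
proof -
  have "2 * form (coords V) L (\<lambda>p. f p - c (snd p)) (\<lambda>p. f p - c (snd p)) = 2 * form (coords V) L f f"
    unfolding form_L_energy by simp
  then show ?thesis by simp
qed

lemma exists_edge:
  assumes "v \<in> V"
  obtains u where "{v, u} \<in> E"
proof -
  have "V - {v} \<noteq> {}" using two_vertices card_mono[of "{v}" V] by force
  then obtain a where "a \<in> V - {v}" by blast
  then have "branch V E v a \<in> branches V E v" by (auto simp: branches_def)
  then show thesis using branch_contains_neighbour[OF tree assms] that by metis
qed

lemma laplacian_kmat: "laplacian s vs E W = kmat (coord_list V) L"
proof -
  have "L = (\<lambda>p q. laplacian_block s E W (fst p) (fst q) $$ (snd p, snd q))"
    by (intro ext) (simp add: L_def)
  moreover have "filter (\<lambda>x. x \<in> V) vs = vs" by simp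
  ultimately show ?thesis
    by (simp add: laplacian_def block_matrix_kmat coord_list_def)
qed

lemma V_ne: "V \<noteq> {}" using two_vertices by force

lemma nonzero_eigenvalue_exists: "\<exists>k. eigenvalue (laplacian s vs E W) k \<and> k \<noteq> 0"
proof -
  have sym: "L p q = L q p" if "p \<in> set (coord_list V)" "q \<in> set (coord_list V)" for p q
    using that by (simp add: L_sym)
  have ne: "coord_list V \<noteq> []" using V_ne by (rule coord_list_ne[OF order_refl])
  obtain k f where k: "\<bar>k\<bar> = rho (kmat (coord_list V) L)" "\<exists>p\<in>set (coord_list V). f p \<noteq> (0::real)"
    "\<forall>p\<in>set (coord_list V). (\<Sum>q\<in>set (coord_list V). L p q * f q) = k * f p"
    "eigenvalue (kmat (coord_list V) L) k"
    by (rule sym_kernel_eigenvector[OF distinct_coord_list ne sym])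
  have "k \<noteq> 0"
  proof
    assume "k = 0"
    then have r: "rho (kmat (coord_list V) L) = 0" using k(1) by simp
    obtain a where a: "a \<in> V" using ex_in_conv[THEN iffD2, OF V_ne] ..
    obtain b where ab: "{a, b} \<in> E" using exists_edge[OF a] .
    let ?f = "\<lambda>p. if fst p = a then 1 else (0::real)"
    have "form (coords V) L ?f ?f = 0"
      using abs_form_le_rho[where K = L and f = ?f, OF distinct_coord_list ne sym] r by simp
    from form_L_zero[OF this ab s_pos] show False using edgeD(3)[OF ab] by simp
  qed
  then show ?thesis using k(4) by (auto simp: laplacian_kmat)
qed

text \<open>
  An eigenvector \<open>f\<close> for a nonzero eigenvalue has blocks that add up to \<open>0\<close>. Therefore \<open>f\<close> is orthogonal
  to every vector that is constant along the vertices, and \<open>|f|\<^sup>2 \<le> |f - c|\<^sup>2\<close>.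
\<close>

lemma le_mu_if_energy_bound:
  assumes k0: "0 \<le> \<kappa>"
    and bound: "\<And>f. \<exists>c. \<kappa> * (\<Sum>p\<in>coords V. (f p - c (snd p))\<^sup>2) \<le> form (coords V) L f f"
  shows "\<kappa> \<le> mu s vs E W"
proof -
  let ?S = "{k. eigenvalue (laplacian s vs E W) k \<and> k \<noteq> 0}"
  have "laplacian s vs E W \<in> carrier_mat (length (coord_list V)) (length (coord_list V))"
    by (simp add: laplacian_kmat)
  then have "finite (spectrum (laplacian s vs E W))" by (rule card_finite_spectrum)
  then have fin: "finite ?S" by (rule rev_finite_subset) (auto simp: spectrum_def)
  have "mu s vs E W \<in> ?S"
    unfolding mu_def using nonzero_eigenvalue_exists by (intro Min_in fin) auto
  then have ev: "eigenvalue (kmat (coord_list V) L) (mu s vs E W)" and nz: "mu s vs E W \<noteq> 0"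
    by (auto simp: laplacian_kmat)
  define k where "k = mu s vs E W"
  obtain f where f: "\<exists>p\<in>coords V. f p \<noteq> 0"
    and Lf: "\<And>p. p \<in> coords V \<Longrightarrow> (\<Sum>q\<in>coords V. L p q * f q) = k * f p"
    using ev unfolding eigenvalue_kmat_iff[OF distinct_coord_list] set_coord_list[OF order_refl] k_def
    by blast
  have mean: "(\<Sum>x\<in>V. f (x, i)) = 0" if i: "i < s" for i
  proof -
    define T where "T x y = (\<Sum>j<s. w x y i j * (f (x, j) - f (y, j)))" for x y
    have "T x y + T y x = 0" for x y
      unfolding T_def w_flip[of y x] sum.distrib[symmetric] by (simp add: algebra_simps)
    then have "(\<Sum>x\<in>V. \<Sum>y\<in>V. T x y) + (\<Sum>x\<in>V. \<Sum>y\<in>V. T y x) = 0"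
      by (simp add: sum.distrib[symmetric])
    moreover have "(\<Sum>x\<in>V. \<Sum>y\<in>V. T y x) = (\<Sum>x\<in>V. \<Sum>y\<in>V. T x y)"
      by (rule sum.swap)
    ultimately have "(\<Sum>x\<in>V. \<Sum>y\<in>V. T x y) = 0" by simp
    moreover have "k * f (x, i) = (\<Sum>y\<in>V. T x y)" if "x \<in> V" for x
      using Lf[of "(x, i)"] L_apply[OF that i, of f] that i by (simp add: T_def)
    ultimately have "k * (\<Sum>x\<in>V. f (x, i)) = 0"
      by (simp add: sum_distrib_left)
    then show ?thesis using nz by (simp add: k_def)
  qed
  let ?N = "\<Sum>p\<in>coords V. (f p)\<^sup>2"
  have N: "0 < ?N" using f by (intro sum_sq_pos) auto
  have energy: "form (coords V) L f f = k * ?N"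
  proof -
    have "form (coords V) L f f = (\<Sum>p\<in>coords V. f p * (k * f p))"
      unfolding form_eq_sum_apply by (intro sum.cong refl) (simp only: Lf)
    then show ?thesis by (simp only: sum_distrib_left power2_eq_square mult.left_commute)
  qed
  obtain c where c: "\<kappa> * (\<Sum>p\<in>coords V. (f p - c (snd p))\<^sup>2) \<le> form (coords V) L f f"
    using bound by blast
  have cross: "(\<Sum>p\<in>coords V. f p * c (snd p)) = 0"
    unfolding sum_coords by (subst sum.swap) (simp add: sum_distrib_right[symmetric] mean)
  have "(\<Sum>p\<in>coords V. (f p - c (snd p))\<^sup>2)
      = ?N + (\<Sum>p\<in>coords V. (c (snd p))\<^sup>2) - 2 * (\<Sum>p\<in>coords V. f p * c (snd p))"
    by (simp add: power2_diff sum.distrib sum_subtractf sum_distrib_left mult.assoc)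
  then have "?N \<le> (\<Sum>p\<in>coords V. (f p - c (snd p))\<^sup>2)"
    unfolding cross by (simp add: sum_nonneg)
  then have "\<kappa> * ?N \<le> k * ?N"
    using c unfolding energy by (rule order_trans[OF mult_left_mono[OF _ k0]])
  then show ?thesis using N by (simp add: k_def)
qed

section \<open>The inverse of the reduced Laplacian\<close>

definition is_green :: "'a \<Rightarrow> ('a \<times> nat \<Rightarrow> 'a \<times> nat \<Rightarrow> real) \<Rightarrow> bool" where
  "is_green v G \<longleftrightarrow> M_mat s vs E W v = kmat (coord_list (V - {v})) G \<and>
    (\<forall>p\<in>coords (V - {v}). \<forall>r\<in>coords (V - {v}).
      (\<Sum>q\<in>coords (V - {v}). L p q * G q r) = (if p = r then 1 else 0)) \<and>
    (\<forall>p\<in>coords (V - {v}). \<forall>r\<in>coords (V - {v}).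
      (\<Sum>q\<in>coords (V - {v}). G p q * L q r) = (if p = r then 1 else 0)) \<and>
    (\<forall>p\<in>coords (V - {v}). \<forall>r\<in>coords (V - {v}). G p r = G r p)"

lemma green_exists:
  assumes v: "v \<in> V"
  shows "\<exists>G. is_green v G"
proof -
  let ?S = "V - {v}" and ?ps = "coord_list (V - {v})"
  have set: "set ?ps = coords ?S" by simp
  have del: "laplacian_del s vs E W v = kmat ?ps L"
  proof -
    have "filter (\<lambda>x. x \<in> V) vs = vs" by simp
    then show ?thesis
      unfolding laplacian_del_def laplacian_kmat coord_list_def by (simp add: principal_blocks_kmat)
  qed
  have sym: "L p q = L q p" if "p \<in> set ?ps" "q \<in> set ?ps" for p q
    using that L_sym unfolding set by auto
  have inj: "\<forall>p\<in>set ?ps. f p = 0" if "\<And>p. p \<in> set ?ps \<Longrightarrow> (\<Sum>q\<in>set ?ps. L p q * f q) = 0" for f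
  proof -
    have "form (coords ?S) L f f = 0"
      unfolding form_eq_sum_apply using that unfolding set by simp
    then show ?thesis unfolding set using form_L_definite[of ?S f] v by blast
  qed
  obtain G where "mat_inv (kmat ?ps L) = kmat ?ps G"
    "\<forall>p\<in>set ?ps. \<forall>r\<in>set ?ps. (\<Sum>q\<in>set ?ps. L p q * G q r) = (if p = r then 1 else 0)"
    "\<forall>p\<in>set ?ps. \<forall>r\<in>set ?ps. (\<Sum>q\<in>set ?ps. G p q * L q r) = (if p = r then 1 else 0)"
    "\<forall>p\<in>set ?ps. \<forall>r\<in>set ?ps. G p r = G r p"
    by (rule kmat_inverse[where K = L, OF distinct_coord_list sym inj])
  then show ?thesis unfolding set M_mat_def del is_green_def by (intro exI[of _ G] conjI)
qed

text \<open>
  The kernel of \<open>M\<^sub>v\<close>; it is the Green function of the tree grounded at \<open>v\<close>.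
\<close>

definition green :: "'a \<Rightarrow> 'a \<times> nat \<Rightarrow> 'a \<times> nat \<Rightarrow> real" where
  "green v = (SOME G. is_green v G)"

lemma
  assumes v: "v \<in> V"
  shows M_mat_kmat: "M_mat s vs E W v = kmat (coord_list (V - {v})) (green v)"
    and L_green: "\<And>p r. p \<in> coords (V - {v}) \<Longrightarrow> r \<in> coords (V - {v}) \<Longrightarrow>
      (\<Sum>q\<in>coords (V - {v}). L p q * green v q r) = (if p = r then 1 else 0)"
    and green_L: "\<And>p r. p \<in> coords (V - {v}) \<Longrightarrow> r \<in> coords (V - {v}) \<Longrightarrow>
      (\<Sum>q\<in>coords (V - {v}). green v p q * L q r) = (if p = r then 1 else 0)"
    and green_sym: "\<And>p r. p \<in> coords (V - {v}) \<Longrightarrow> r \<in> coords (V - {v}) \<Longrightarrow> green v p r = green v r p"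
proof -
  have "is_green v (green v)"
    unfolding green_def by (rule someI_ex[OF green_exists[OF v]])
  note g = this[unfolded is_green_def]
  note M = g[THEN conjunct1] and LG = g[THEN conjunct2, THEN conjunct1]
    and GL = g[THEN conjunct2, THEN conjunct2, THEN conjunct1]
    and sym = g[THEN conjunct2, THEN conjunct2, THEN conjunct2]
  show "M_mat s vs E W v = kmat (coord_list (V - {v})) (green v)" by (rule M)
  fix p r assume pr: "p \<in> coords (V - {v})" "r \<in> coords (V - {v})"
  show "(\<Sum>q\<in>coords (V - {v}). L p q * green v q r) = (if p = r then 1 else 0)"
    by (rule bspec[OF bspec[OF LG pr(1)] pr(2)])
  show "(\<Sum>q\<in>coords (V - {v}). green v p q * L q r) = (if p = r then 1 else 0)"
    by (rule bspec[OF bspec[OF GL pr(1)] pr(2)])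
  show "green v p r = green v r p"
    by (rule bspec[OF bspec[OF sym pr(1)] pr(2)])
qed

lemma bottleneck_kmat:
  assumes v: "v \<in> V" and B: "B \<subseteq> V - {v}"
  shows "bottleneck s vs E W v B = kmat (coord_list B) (green v)"
proof -
  have 1: "filter (\<lambda>w. w \<noteq> v) vs = filter (\<lambda>x. x \<in> V - {v}) vs" by (rule filter_cong) auto
  have 2: "filter (\<lambda>x. x \<in> B) (filter (\<lambda>x. x \<in> V - {v}) vs) = filter (\<lambda>x. x \<in> B) vs"
    unfolding filter_filter by (rule filter_cong[OF refl]) (use B in blast)
  have "bottleneck s vs E W v B = principal_blocks s (filter (\<lambda>x. x \<in> V - {v}) vs) B
      (kmat (List.product (filter (\<lambda>x. x \<in> V - {v}) vs) [0..<s]) (green v))"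
    by (simp only: bottleneck_def M_mat_kmat[OF v] 1 coord_list_def)
  also have "\<dots> = kmat (coord_list B) (green v)"
    by (simp only: principal_blocks_kmat 2 coord_list_def)
  finally show ?thesis .
qed

end

section \<open>Perron branches\<close>

lemma form_Un_disjoint:
  assumes "finite X" "finite Y" "X \<inter> Y = {}"
    and sym: "\<And>p q. p \<in> X \<Longrightarrow> q \<in> Y \<Longrightarrow> K p q = K q p"
  shows "form (X \<union> Y) K f f = form X K f f + form Y K f f + 2 * (\<Sum>p\<in>X. \<Sum>q\<in>Y. f p * K p q * f q)"
proof -
  have "(\<Sum>p\<in>Y. \<Sum>q\<in>X. f p * K p q * f q) = (\<Sum>q\<in>X. \<Sum>p\<in>Y. f p * K p q * f q)"
    by (rule sum.swap)
  also have "\<dots> = (\<Sum>p\<in>X. \<Sum>q\<in>Y. f p * K p q * f q)"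
  proof (intro sum.cong refl)
    fix p q assume "p \<in> X" "q \<in> Y"
    then show "f q * K q p * f p = f p * K p q * f q" using sym[of p q] by simp
  qed
  finally show ?thesis
    using assms(1-3) by (simp add: form_def sum.union_disjoint sum.distrib)
qed

lemma rho_kmat_mono:
  assumes d: "distinct ps" "distinct qs" and ne: "ps \<noteq> []" and sub: "set ps \<subseteq> set qs"
    and sym: "\<And>p q. p \<in> set qs \<Longrightarrow> q \<in> set qs \<Longrightarrow> K p q = K q p"
  shows "rho (kmat ps K) \<le> rho (kmat qs K)"
proof -
  have symp: "K p q = K q p" if "p \<in> set ps" "q \<in> set ps" for p q
    using sym that sub by blast
  obtain f where f: "0 < (\<Sum>p\<in>set ps. (f p)\<^sup>2)"
    "\<bar>form (set ps) K f f\<bar> = rho (kmat ps K) * (\<Sum>p\<in>set ps. (f p)\<^sup>2)"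
    by (rule rho_attained[where K = K, OF d(1) ne symp])
  define g where "g p = (if p \<in> set ps then f p else 0)" for p
  have "form (set qs) K g g = form (set ps) K f f"
    by (rule form_restrict[OF _ sub]) (simp_all add: g_def)
  moreover have "(\<Sum>p\<in>set qs. (g p)\<^sup>2) = (\<Sum>p\<in>set ps. (f p)\<^sup>2)"
    using sub by (intro sum.mono_neutral_cong_right) (auto simp: g_def)
  moreover have "qs \<noteq> []" using ne sub by auto
  then have "\<bar>form (set qs) K g g\<bar> \<le> rho (kmat qs K) * (\<Sum>p\<in>set qs. (g p)\<^sup>2)"
    by (rule abs_form_le_rho[where K = K, OF d(2) _ sym])
  ultimately show ?thesis using f by simp
qed

context weighted_tree
begin

lemma branchesD:
  assumes "D \<in> branches V E v"
  shows "D \<subseteq> V - {v}" "D \<noteq> {}"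
proof -
  obtain u where "u \<in> V - {v}" "D = branch V E v u" using assms by (auto simp: branches_def)
  then show "D \<subseteq> V - {v}" "D \<noteq> {}" using branch_subset[of V E v u] branch_self[of u V v E] by auto
qed

lemma L_no_edge:
  assumes "{fst p, fst q} \<notin> E" "fst p \<noteq> fst q" "snd p < s" "snd q < s"
  shows "L p q = 0"
  using L_offdiag[of "fst p" "fst q" "snd p" "snd q"] assms by (simp add: w_def)

lemma L_across_branches:
  assumes D: "D \<in> branches V E v" and p: "p \<in> coords D" and q: "q \<in> coords (V - {v}) - coords D"
  shows "L p q = 0"
proof -
  obtain u where "D = branch V E v u" using D by (auto simp: branches_def)
  then have "{fst p, fst q} \<notin> E" using branch_closed[OF tree, of "fst p" v u "fst q"] p q by auto
  then show ?thesis using p q by (intro L_no_edge) auto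
qed

lemma sum_L_branch:
  assumes D: "D \<in> branches V E v" and p: "p \<in> coords D"
  shows "(\<Sum>q\<in>coords D. L p q * g q) = (\<Sum>q\<in>coords (V - {v}). L p q * g q)"
  using branchesD(1)[OF D] L_across_branches[OF D p]
  by (intro sum.mono_neutral_left) auto

lemma L_green_branch:
  assumes v: "v \<in> V" and D: "D \<in> branches V E v" and p: "p \<in> coords D" and r: "r \<in> coords (V - {v})"
  shows "(\<Sum>q\<in>coords D. L p q * green v q r) = (if p = r then 1 else 0)"
  unfolding sum_L_branch[OF D p] using branchesD(1)[OF D] p r by (intro L_green[OF v]) auto

text \<open>
  \<open>M\<^sub>v\<close> is block diagonal: the part on \<open>D\<close> of a column that belongs to another branch has energy \<open>0\<close>,
  because no edge leads from \<open>D\<close> to another branch.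
\<close>

lemma green_across_branches:
  assumes v: "v \<in> V" and D: "D \<in> branches V E v" and p: "p \<in> coords D"
    and r: "r \<in> coords (V - {v}) - coords D"
  shows "green v p r = 0"
proof -
  let ?g = "\<lambda>q. green v q r"
  have "(\<Sum>q\<in>coords D. L p q * ?g q) = 0" if "p \<in> coords D" for p
    using L_green_branch[OF v D that, of r] r that by auto
  then have "form (coords D) L ?g ?g = 0" unfolding form_eq_sum_apply by simp
  then show ?thesis
    using form_L_definite[of D ?g p] branchesD(1)[OF D] v p by blast
qed

lemma form_green_branches:
  assumes v: "v \<in> V"
  shows "form (coords (V - {v})) (green v) f f = (\<Sum>D\<in>branches V E v. form (coords D) (green v) f f)"
    and "(\<Sum>p\<in>coords (V - {v}). h p) = (\<Sum>D\<in>branches V E v. \<Sum>p\<in>coords D. (h p :: real))"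
proof -
  let ?Bs = "branches V E v"
  have fin: "finite ?Bs" by (simp add: branches_def)
  have finD: "finite (coords D)" if "D \<in> ?Bs" for D
    using finite_subset[OF branchesD(1)[OF that]] by simp
  have Un: "coords (V - {v}) = (\<Union>D\<in>?Bs. coords D)"
    using Union_branches[of V E v] by auto
  have split: "(\<Sum>p\<in>coords (V - {v}). h p) = (\<Sum>D\<in>?Bs. \<Sum>p\<in>coords D. h p)" for h :: "'a \<times> nat \<Rightarrow> real"
    unfolding Un
  proof (rule sum.UNION_disjoint[OF fin])
    show "\<forall>D\<in>?Bs. finite (coords D)" using finD by blast
    show "\<forall>D\<in>?Bs. \<forall>D'\<in>?Bs. D \<noteq> D' \<longrightarrow> coords D \<inter> coords D' = {}"
      using branches_disjoint[of _ V E v] by blast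
  qed
  show "(\<Sum>p\<in>coords (V - {v}). h p) = (\<Sum>D\<in>?Bs. \<Sum>p\<in>coords D. h p)" by (rule split)
  have "form (coords (V - {v})) (green v) f f
      = (\<Sum>D\<in>?Bs. \<Sum>p\<in>coords D. f p * (\<Sum>q\<in>coords (V - {v}). green v p q * f q))"
    unfolding form_eq_sum_apply by (rule split)
  also have "\<dots> = (\<Sum>D\<in>?Bs. \<Sum>p\<in>coords D. f p * (\<Sum>q\<in>coords D. green v p q * f q))"
  proof -
    have "(\<Sum>q\<in>coords (V - {v}). green v p q * f q) = (\<Sum>q\<in>coords D. green v p q * f q)"
      if D: "D \<in> ?Bs" and p: "p \<in> coords D" for D p
      using branchesD(1)[OF D] green_across_branches[OF v D p]
      by (intro sum.mono_neutral_right) auto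
    then show ?thesis by (intro sum.cong refl) (simp only:)
  qed
  finally show "form (coords (V - {v})) (green v) f f = (\<Sum>D\<in>?Bs. form (coords D) (green v) f f)"
    unfolding form_eq_sum_apply .
qed

lemma delete_ne: "v \<in> V \<Longrightarrow> V - {v} \<noteq> {}"
  using two_vertices card_mono[of "{v}" V] by force

text \<open>
  The form of \<open>M\<^sub>v\<close> at \<open>f\<close> is the sum of the forms of the bottleneck matrices at the parts of \<open>f\<close>. It
  falls short of \<open>\<rho>(M\<^sub>v) |f|\<^sup>2\<close> as soon as all parts with \<open>\<rho>(M\<^sub>v(D)) = \<rho>(M\<^sub>v)\<close> vanish.
\<close>

lemma perron_branch_in_support:
  assumes v: "v \<in> V" and N: "0 < (\<Sum>p\<in>coords (V - {v}). (f p)\<^sup>2)"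
    and big: "rho (M_mat s vs E W v) * (\<Sum>p\<in>coords (V - {v}). (f p)\<^sup>2)
      \<le> \<bar>form (coords (V - {v})) (green v) f f\<bar>"
  obtains D p where "perron_branch s vs E W v D" "p \<in> coords D" "f p \<noteq> 0"
proof -
  let ?Bs = "branches V E v"
  let ?N = "\<lambda>D. \<Sum>p\<in>coords D. (f p)\<^sup>2"
  let ?R = "rho (M_mat s vs E W v)"
  let ?r = "\<lambda>D. rho (bottleneck s vs E W v D)"
  have fin: "finite ?Bs" by (simp add: branches_def)
  have sym: "green v p q = green v q p" if "p \<in> set (coord_list (V - {v}))" "q \<in> set (coord_list (V - {v}))" for p q
  proof -
    have "set (coord_list (V - {v})) = coords (V - {v})" by (rule set_coord_list) blast
    with that show ?thesis using green_sym[OF v, of p q] by simp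
  qed
  have D: "D \<subseteq> V" "coord_list D \<noteq> []" "set (coord_list D) = coords D"
    "set (coord_list D) \<subseteq> set (coord_list (V - {v}))"
    "bottleneck s vs E W v D = kmat (coord_list D) (green v)" if "D \<in> ?Bs" for D
  proof -
    note DB = branchesD[OF that]
    show "D \<subseteq> V" using DB by auto
    then show "coord_list D \<noteq> []" "set (coord_list D) = coords D" using DB coord_list_ne by auto
    then show "set (coord_list D) \<subseteq> set (coord_list (V - {v}))" using DB by auto
    show "bottleneck s vs E W v D = kmat (coord_list D) (green v)" by (rule bottleneck_kmat[OF v DB(1)])
  qed
  have rR: "?r D \<le> ?R" if "D \<in> ?Bs" for D
    unfolding D(5)[OF that] M_mat_kmat[OF v]
    by (rule rho_kmat_mono[where K = "green v", OF _ _ D(2)[OF that] D(4)[OF that] sym]) auto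
  have form_le: "\<bar>form (coords D) (green v) f f\<bar> \<le> ?r D * ?N D" if "D \<in> ?Bs" for D
  proof -
    have symD: "green v p q = green v q p" if "p \<in> set (coord_list D)" "q \<in> set (coord_list D)" for p q
      using sym D(4)[OF \<open>D \<in> ?Bs\<close>] that by blast
    show ?thesis
      using abs_form_le_rho[where K = "green v" and f = f, OF distinct_coord_list D(2)[OF that] symD]
      unfolding D(3)[OF that] D(5)[OF that] .
  qed
  have N0: "0 \<le> ?N D" for D by (simp add: sum_nonneg)
  have total: "(\<Sum>D\<in>?Bs. ?N D) = (\<Sum>p\<in>coords (V - {v}). (f p)\<^sup>2)"
    by (rule form_green_branches(2)[OF v, symmetric])
  have "\<exists>D\<in>?Bs. ?r D = ?R \<and> 0 < ?N D"
  proof (rule ccontr)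
    assume neg: "\<not> ?thesis"
    have "\<exists>D\<in>?Bs. 0 < ?N D"
    proof (rule ccontr)
      assume "\<not> ?thesis"
      then have "?N D \<le> 0" if "D \<in> ?Bs" for D using that by (meson not_less)
      then have "(\<Sum>D\<in>?Bs. ?N D) \<le> 0" by (rule sum_nonpos)
      then show False using N total by simp
    qed
    then obtain D0 where D0: "D0 \<in> ?Bs" "0 < ?N D0" by blast
    have "?r D0 < ?R" using neg D0 rR[OF D0(1)] by fastforce
    then have "?r D0 * ?N D0 < ?R * ?N D0" using D0 by simp
    then have "(\<Sum>D\<in>?Bs. ?r D * ?N D) < (\<Sum>D\<in>?Bs. ?R * ?N D)"
      using D0 rR N0
      by (intro sum_strict_mono_ex1[OF fin] ballI bexI[of _ D0] mult_right_mono) blast+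
    also have "\<dots> \<le> \<bar>form (coords (V - {v})) (green v) f f\<bar>"
      using big by (simp only: total sum_distrib_left[symmetric])
    also have "\<dots> \<le> (\<Sum>D\<in>?Bs. \<bar>form (coords D) (green v) f f\<bar>)"
      unfolding form_green_branches(1)[OF v] by (rule sum_abs)
    also have "\<dots> \<le> (\<Sum>D\<in>?Bs. ?r D * ?N D)" by (intro sum_mono form_le)
    finally show False by simp
  qed
  then obtain D where D': "D \<in> ?Bs" "?r D = ?R" "0 < ?N D" by blast
  have "\<exists>p\<in>coords D. f p \<noteq> 0"
  proof (rule ccontr)
    assume "\<not> ?thesis"
    then have "?N D = 0" by (intro sum.neutral) auto
    then show False using D'(3) by simp
  qed
  then show thesis using that D' by (auto simp: perron_branch_def)
qed

lemma sym_green_list: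
  assumes "v \<in> V" "S \<subseteq> V - {v}" "p \<in> set (coord_list S)" "q \<in> set (coord_list S)"
  shows "green v p q = green v q p"
proof -
  have "S \<subseteq> V" using assms(2) by blast
  then show ?thesis using assms green_sym[OF assms(1), of p q] by auto
qed

lemma perron_branch_exists:
  assumes v: "v \<in> V"
  obtains D where "perron_branch s vs E W v D"
proof -
  have ne: "coord_list (V - {v}) \<noteq> []" using delete_ne[OF v] by (intro coord_list_ne) auto
  have set: "set (coord_list (V - {v})) = coords (V - {v})" by (rule set_coord_list) blast
  obtain f where "0 < (\<Sum>p\<in>set (coord_list (V - {v})). (f p)\<^sup>2)"
    "\<bar>form (set (coord_list (V - {v}))) (green v) f f\<bar>
      = rho (kmat (coord_list (V - {v})) (green v)) * (\<Sum>p\<in>set (coord_list (V - {v})). (f p)\<^sup>2)"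
    by (rule rho_attained[where K = "green v", OF distinct_coord_list ne sym_green_list[OF v order_refl]])
  then show thesis
    using perron_branch_in_support[OF v, of f] that unfolding set M_mat_kmat[OF v, symmetric] by auto
qed

lemma form_green_le:
  assumes v: "v \<in> V"
  shows "\<bar>form (coords (V - {v})) (green v) f f\<bar>
    \<le> rho (M_mat s vs E W v) * (\<Sum>p\<in>coords (V - {v}). (f p)\<^sup>2)"
proof -
  have ne: "coord_list (V - {v}) \<noteq> []" using delete_ne[OF v] by (intro coord_list_ne) auto
  have set: "set (coord_list (V - {v})) = coords (V - {v})" by (rule set_coord_list) blast
  show ?thesis
    using abs_form_le_rho[where K = "green v" and f = f,
        OF distinct_coord_list ne sym_green_list[OF v order_refl]]
    unfolding set M_mat_kmat[OF v] .
qed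

lemma form_L_ge_green:
  assumes v: "v \<in> V" and c: "0 < c" "rho (M_mat s vs E W v) \<le> c"
  shows "(\<Sum>p\<in>coords (V - {v}). (y p)\<^sup>2) / c \<le> form (coords (V - {v})) L y y"
proof (rule form_ge_of_inverse[where S = "green v"])
  show "L p q = L q p" if "p \<in> coords (V - {v})" "q \<in> coords (V - {v})" for p q
    using that by (intro L_sym) auto
  show "0 \<le> form (coords (V - {v})) L f f" for f by (rule form_L_part_nonneg) blast
  have "form (coords (V - {v})) (green v) y y
      \<le> rho (M_mat s vs E W v) * (\<Sum>p\<in>coords (V - {v}). (y p)\<^sup>2)"
    using form_green_le[OF v, of y] by linarith
  also have "\<dots> \<le> c * (\<Sum>p\<in>coords (V - {v}). (y p)\<^sup>2)"
    using c by (intro mult_right_mono sum_nonneg) auto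
  finally show "form (coords (V - {v})) (green v) y y \<le> c * (\<Sum>p\<in>coords (V - {v}). (y p)\<^sup>2)" .
qed (simp_all add: c L_green[OF v] del: mem_Sigma_iff SigmaE)

text \<open>
  If the radius were \<open>0\<close>, the energy of the all-ones vector would exceed every bound, since the
  preceding lemma could be applied with arbitrarily small \<open>c\<close>.
\<close>

lemma rho_M_mat_pos:
  assumes v: "v \<in> V"
  shows "0 < rho (M_mat s vs E W v)"
proof (rule ccontr)
  assume "\<not> ?thesis"
  then have R: "rho (M_mat s vs E W v) \<le> 0" by simp
  define F where "F = form (coords (V - {v})) L (\<lambda>_. 1) (\<lambda>_. 1)"
  define N where "N = (\<Sum>p\<in>coords (V - {v}). (1::real)\<^sup>2)"
  have F: "0 \<le> F" unfolding F_def by (rule form_L_part_nonneg) blast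
  have "coords (V - {v}) \<noteq> {}" using delete_ne[OF v] s_pos by auto
  then have N: "0 < N" unfolding N_def by (intro sum_sq_pos) auto
  have c: "0 < N / (F + 1)" using F N by simp
  \<comment> \<open>The bound at \<open>c = N / (F + 1)\<close> reads \<open>F + 1 \<le> F\<close>.\<close>
  have "N / (N / (F + 1)) \<le> F"
    unfolding N_def[symmetric] F_def[symmetric]
    using form_L_ge_green[OF v c, of "\<lambda>_. 1"] R c unfolding F_def[symmetric] N_def[symmetric] by linarith
  then show False using N by simp
qed

section \<open>The bound from a vertex\<close>

lemma vertex_bound:
  assumes v: "v \<in> V"
  shows "1 / rho (M_mat s vs E W v) \<le> mu s vs E W"
proof (rule le_mu_if_energy_bound)
  let ?r = "rho (M_mat s vs E W v)"
  have r: "0 < ?r" by (rule rho_M_mat_pos[OF v])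
  then show "0 \<le> 1 / ?r" by simp
  fix f :: "'a \<times> nat \<Rightarrow> real"
  define y where "y p = f p - f (v, snd p)" for p
  have y0: "y p = 0" if "p \<in> coords V - coords (V - {v})" for p
    using that by (auto simp: y_def)
  have "(\<Sum>p\<in>coords V. (y p)\<^sup>2) = (\<Sum>p\<in>coords (V - {v}). (y p)\<^sup>2)"
    using y0 by (intro sum.mono_neutral_right) auto
  moreover have "form (coords V) L y y = form (coords (V - {v})) L y y"
    by (rule form_restrict) (use y0 in auto)
  moreover have "form (coords V) L y y = form (coords V) L f f"
    unfolding y_def by (rule form_L_shift[of f "\<lambda>i. f (v, i)"])
  ultimately have "1 / ?r * (\<Sum>p\<in>coords V. (y p)\<^sup>2) \<le> form (coords V) L f f"
    using form_L_ge_green[OF v r order_refl, of y] by simp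
  then show "\<exists>c. 1 / ?r * (\<Sum>p\<in>coords V. (f p - c (snd p))\<^sup>2) \<le> form (coords V) L f f"
    unfolding y_def by (intro exI[of _ "\<lambda>i. f (v, i)"])
qed

section \<open>The bound from an edge\<close>

definition winv :: "'a set \<Rightarrow> nat \<Rightarrow> nat \<Rightarrow> real" where
  "winv e i j = mat_inv (W e) $$ (i, j)"

lemma
  assumes e: "{x, y} \<in> E"
  shows winv_carrier: "mat_inv (W {x, y}) \<in> carrier_mat s s"
    and w_winv: "\<And>i k. i < s \<Longrightarrow> k < s \<Longrightarrow> (\<Sum>j<s. w x y i j * winv {x, y} j k) = (if i = k then 1 else 0)"
    and winv_w: "\<And>i k. i < s \<Longrightarrow> k < s \<Longrightarrow> (\<Sum>j<s. winv {x, y} i j * w x y j k) = (if i = k then 1 else 0)"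
    and winv_sym: "\<And>i j. i < s \<Longrightarrow> j < s \<Longrightarrow> winv {x, y} i j = winv {x, y} j i"
proof -
  let ?W = "W {x, y}"
  have W: "?W \<in> carrier_mat s s" "transpose_mat ?W = ?W"
    "\<forall>x\<in>carrier_vec s. x \<noteq> 0\<^sub>v s \<longrightarrow> 0 < x \<bullet> (?W *\<^sub>v x)"
    using weights[OF e] by (auto simp: sym_pos_def_def)
  have inj: "z = 0\<^sub>v s" if "z \<in> carrier_vec s" "?W *\<^sub>v z = 0\<^sub>v s" for z
    using W(3) that by (metis less_irrefl scalar_prod_right_zero)
  note inv = mat_inv_inverse[OF W(1) inj]
  show "mat_inv ?W \<in> carrier_mat s s" by (rule inv)
  show "winv {x, y} i j = winv {x, y} j i" if "i < s" "j < s" for i j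
    using mat_inv_symmetric[OF W(1,2) inj] inv(1) that
    by (metis winv_def carrier_matD index_transpose_mat(1))
  fix i k assume ik: "i < s" "k < s"
  show "(\<Sum>j<s. w x y i j * winv {x, y} j k) = (if i = k then 1 else 0)"
    using arg_cong[OF inv(2), of "\<lambda>A. A $$ (i, k)"] ik W(1) inv(1) e
    by (simp add: scalar_prod_def winv_def w_def lessThan_atLeast0)
  show "(\<Sum>j<s. winv {x, y} i j * w x y j k) = (if i = k then 1 else 0)"
    using arg_cong[OF inv(3), of "\<lambda>A. A $$ (i, k)"] ik W(1) inv(1) e
    by (simp add: scalar_prod_def winv_def w_def lessThan_atLeast0)
qed

definition split_kernel :: "'a \<Rightarrow> 'a \<Rightarrow> real \<Rightarrow> 'a \<times> nat \<Rightarrow> 'a \<times> nat \<Rightarrow> real" where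
  "split_kernel u v t p q = green u p q - t * winv {u, v} (snd p) (snd q)"

lemma neighbour_branch:
  assumes uv: "{u, v} \<in> E"
  shows "branch V E u v \<in> branches V E u" "branch V E u v \<subseteq> V - {u}" "v \<in> branch V E u v"
    "branch V E u v \<subseteq> V" "set (coord_list (branch V E u v)) = coords (branch V E u v)"
    "coord_list (branch V E u v) \<noteq> []"
proof -
  note e = edgeD[OF uv]
  show "branch V E u v \<in> branches V E u" using e by (auto simp: branches_def)
  show "branch V E u v \<subseteq> V - {u}" by (rule branch_subset)
  then show sub: "branch V E u v \<subseteq> V" by blast
  show v: "v \<in> branch V E u v" using e by (intro branch_self) auto
  show "set (coord_list (branch V E u v)) = coords (branch V E u v)" by (rule set_coord_list[OF sub])
  show "coord_list (branch V E u v) \<noteq> []" using v by (intro coord_list_ne[OF sub]) auto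
qed

lemma split_bottleneck_kmat:
  assumes uv: "{u, v} \<in> E"
  shows "split_bottleneck s vs E W u v t = kmat (coord_list (branch V E u v)) (split_kernel u v t)"
proof -
  let ?B = "branch V E u v"
  let ?K = "kronecker (all_ones (card ?B)) (mat_inv (W {u, v}))"
  note B = neighbour_branch[OF uv]
  have bott: "bottleneck s vs E W u ?B = kmat (coord_list ?B) (green u)"
    using edgeD(1)[OF uv] B(2) by (rule bottleneck_kmat)
  have "{x \<in> V. x \<in> ?B} = ?B" using B(4) by blast
  then have "card ?B = length (filter (\<lambda>x. x \<in> ?B) vs)"
    using distinct_card[of "filter (\<lambda>x. x \<in> ?B) vs"] distinct by simp
  then have len: "length (coord_list ?B) = card ?B * s" by (simp add: coord_list_def)
  have snd: "snd (coord_list ?B ! i) = i mod s" if "i < card ?B * s" for i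
    using that len s_pos unfolding coord_list_def by (simp add: product_nth)
  have K: "?K = mat (card ?B * s) (card ?B * s) (\<lambda>(i, j). winv {u, v} (i mod s) (j mod s))"
    using winv_carrier[OF uv] s_pos
    by (intro eq_matI) (auto simp: kronecker_def all_ones_def winv_def less_mult_imp_div_less)
  show ?thesis
    unfolding split_bottleneck_def Let_def bott K
    by (rule eq_matI) (auto simp: kmat_def len split_kernel_def snd)
qed

lemma split_kernel_sym:
  assumes uv: "{u, v} \<in> E" and pq: "p \<in> coords (branch V E u v)" "q \<in> coords (branch V E u v)"
  shows "split_kernel u v t p q = split_kernel u v t q p"
proof -
  note B = neighbour_branch[OF uv]
  have "green u p q = green u q p"
    using B(2) pq by (intro green_sym[OF edgeD(1)[OF uv]]) auto
  moreover have "winv {u, v} (snd p) (snd q) = winv {u, v} (snd q) (snd p)"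
    using pq by (intro winv_sym[OF uv]) auto
  ultimately show ?thesis by (simp add: split_kernel_def)
qed

lemma w_out_of_branch:
  assumes uv: "{u, v} \<in> E" and "x \<in> branch V E u v" "y \<notin> branch V E u v" "\<not> (x = v \<and> y = u)"
  shows "w x y i j = 0"
  using edge_leaving_branch[OF tree uv, of x y] assms by (auto simp: w_def)

text \<open>
  The Laplacian of the branch kills constants. What is left is the diagonal block that the cut edge
  \<open>{u, v}\<close> contributes at \<open>v\<close>.
\<close>

lemma L_const_on_branch:
  assumes uv: "{u, v} \<in> E" and p: "p \<in> coords (branch V E u v)"
  shows "(\<Sum>q\<in>coords (branch V E u v). L p q * c (snd q))
    = (if fst p = v then \<Sum>j<s. w u v (snd p) j * c j else 0)"
proof -
  let ?B = "branch V E u v"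
  note B = neighbour_branch[OF uv]
  obtain x i where xi: "p = (x, i)" "x \<in> ?B" "i < s" using p by auto
  have uV: "u \<in> V" and uB: "u \<notin> ?B" using edgeD[OF uv] B(2) by auto
  have "(\<Sum>q\<in>coords ?B. L p q * c (snd q))
      = (\<Sum>y\<in>V. \<Sum>j<s. w x y i j * (c j - (if y \<in> ?B then c j else 0)))"
    using L_apply_part[OF B(4), of x i "\<lambda>q. c (snd q)", unfolded snd_conv] xi B(4) by auto
  also have "\<dots> = (\<Sum>y\<in>V. if y = u then if x = v then \<Sum>j<s. w x y i j * c j else 0 else 0)"
  proof (intro sum.cong refl)
    fix y assume "y \<in> V"
    show "(\<Sum>j<s. w x y i j * (c j - (if y \<in> ?B then c j else 0)))
        = (if y = u then if x = v then \<Sum>j<s. w x y i j * c j else 0 else 0)"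
      using w_out_of_branch[OF uv xi(2), of y] uB by (cases "y \<in> ?B") auto
  qed
  also have "\<dots> = (if x = v then \<Sum>j<s. w x u i j * c j else 0)" using uV by simp
  finally show ?thesis using xi by (simp add: w_flip[of v u])
qed

text \<open>
  Pair the column of \<open>r\<close> with a constant vector on the branch. Moving the Laplacian from the column to
  the constant leaves only the block at \<open>v\<close>, multiplied by \<open>W(e)\<close>, and the pairing itself is read off
  at \<open>r\<close>. This is the path formula for \<open>M\<^sub>u(v)\<close> in the row of \<open>v\<close>: every path from the branch to \<open>u\<close>
  shares exactly the edge \<open>e\<close> with the path from \<open>v\<close>.
\<close>

lemma green_at_neighbour:
  assumes uv: "{u, v} \<in> E" and r: "r \<in> coords (branch V E u v)" and j: "j < s"
  shows "green u (v, j) r = winv {u, v} j (snd r)"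
proof -
  let ?B = "branch V E u v" and ?g = "\<lambda>q. green u q r"
  note B = neighbour_branch[OF uv] and e = edgeD[OF uv]
  have rV: "r \<in> coords (V - {u})" using r B(2) by auto
  have fin: "finite (coords ?B)" using finite_subset[OF B(4)] by simp
  have Wg: "(\<Sum>j<s. w u v i j * ?g (v, j)) = (if i = snd r then 1 else 0)" if i: "i < s" for i
  proof -
    let ?c = "\<lambda>k. if k = i then 1 else (0::real)"
    have "(\<Sum>p\<in>coords ?B. ?c (snd p) * (\<Sum>q\<in>coords ?B. L p q * ?g q))
        = (\<Sum>p\<in>coords ?B. if p = r then ?c (snd p) else 0)"
      by (intro sum.cong refl) (simp only: L_green_branch[OF e(1) B(1) _ rV], simp)
    also have "\<dots> = ?c (snd r)" using fin r by simp
    finally have "?c (snd r) = (\<Sum>p\<in>coords ?B. \<Sum>q\<in>coords ?B. ?c (snd p) * (L p q * ?g q))"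
      by (simp only: sum_distrib_left)
    also have "\<dots> = (\<Sum>q\<in>coords ?B. \<Sum>p\<in>coords ?B. ?c (snd p) * (L p q * ?g q))"
      by (rule sum.swap)
    also have "\<dots> = (\<Sum>q\<in>coords ?B. ?g q * (\<Sum>p\<in>coords ?B. L q p * ?c (snd p)))"
    proof (intro sum.cong refl)
      fix q assume q: "q \<in> coords ?B"
      have "L p q = L q p" if "p \<in> coords ?B" for p
        using that q B(4) by (intro L_sym) auto
      then have "(\<Sum>p\<in>coords ?B. ?c (snd p) * (L p q * ?g q)) = (\<Sum>p\<in>coords ?B. ?g q * (L q p * ?c (snd p)))"
        by (intro sum.cong refl) (simp only: mult_ac)
      then show "(\<Sum>p\<in>coords ?B. ?c (snd p) * (L p q * ?g q)) = ?g q * (\<Sum>p\<in>coords ?B. L q p * ?c (snd p))"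
        by (simp only: sum_distrib_left)
    qed
    also have "\<dots> = (\<Sum>q\<in>coords ?B. ?g q * (if fst q = v then \<Sum>j<s. w u v (snd q) j * ?c j else 0))"
      by (intro sum.cong refl) (simp only: L_const_on_branch[OF uv, of _ ?c])
    also have "\<dots> = (\<Sum>q\<in>coords ?B. if fst q = v then ?g q * w u v (snd q) i else 0)"
      using i by (intro sum.cong refl) (simp add: if_distrib[of "\<lambda>x. _ * x"] cong: if_cong)
    also have "\<dots> = (\<Sum>x\<in>?B. if x = v then \<Sum>j<s. ?g (x, j) * w u v j i else 0)"
      unfolding sum_coords by (intro sum.cong refl) simp
    also have "\<dots> = (\<Sum>j<s. ?g (v, j) * w u v j i)"
      using B(3) finite_subset[OF B(4)] by simp
    also have "\<dots> = (\<Sum>j<s. w u v i j * ?g (v, j))"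
      using i by (intro sum.cong refl) (simp add: w_sym)
    finally show ?thesis by (auto split: if_splits)
  qed
  have "winv {u, v} j (snd r) = (\<Sum>i<s. winv {u, v} j i * (\<Sum>k<s. w u v i k * ?g (v, k)))"
    using r by (auto simp: Wg if_distrib[of "\<lambda>x. _ * x"] cong: if_cong)
  also have "\<dots> = (\<Sum>i<s. \<Sum>k<s. winv {u, v} j i * w u v i k * ?g (v, k))"
    by (simp add: sum_distrib_left mult.assoc)
  also have "\<dots> = (\<Sum>k<s. (\<Sum>i<s. winv {u, v} j i * w u v i k) * ?g (v, k))"
    by (subst sum.swap) (simp add: sum_distrib_right)
  also have "\<dots> = (\<Sum>k<s. if j = k then ?g (v, k) else 0)"
    using j by (intro sum.cong refl) (simp add: winv_w[OF uv])
  also have "\<dots> = ?g (v, j)" using j by simp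
  finally show ?thesis ..
qed

lemma split_kernel_at_neighbour:
  assumes "{u, v} \<in> E" "r \<in> coords (branch V E u v)" "j < s"
  shows "split_kernel u v t (v, j) r = (1 - t) * winv {u, v} j (snd r)"
  using green_at_neighbour[OF assms] by (simp add: split_kernel_def left_diff_distrib)

lemma L_split_kernel:
  assumes uv: "{u, v} \<in> E" and p: "p \<in> coords (branch V E u v)" and r: "r \<in> coords (branch V E u v)"
  shows "(\<Sum>q\<in>coords (branch V E u v). L p q * split_kernel u v t q r)
    = (if p = r then 1 else 0) - (if fst p = v \<and> snd p = snd r then t else 0)"
proof -
  let ?B = "branch V E u v"
  note B = neighbour_branch[OF uv]
  have rV: "r \<in> coords (V - {u})" using r B(2) by auto
  have "(\<Sum>q\<in>coords ?B. L p q * split_kernel u v t q r)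
      = (\<Sum>q\<in>coords ?B. L p q * green u q r) - t * (\<Sum>q\<in>coords ?B. L p q * winv {u, v} (snd q) (snd r))"
    by (simp add: split_kernel_def right_diff_distrib sum_subtractf sum_distrib_left mult.left_commute)
  also have "(\<Sum>q\<in>coords ?B. L p q * green u q r) = (if p = r then 1 else 0)"
    by (rule L_green_branch[OF edgeD(1)[OF uv] B(1) p rV])
  also have "(\<Sum>q\<in>coords ?B. L p q * winv {u, v} (snd q) (snd r))
      = (if fst p = v \<and> snd p = snd r then 1 else 0)"
    unfolding L_const_on_branch[OF uv p, of "\<lambda>j. winv {u, v} j (snd r)"]
    using w_winv[OF uv, of "snd p" "snd r"] p r by auto
  finally show ?thesis by simp
qed

text \<open>
  Raising the weight of the edge between the branch and its ground from \<open>W(e)\<close> to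
  \<open>W(e) / (1 - t)\<close> adds \<open>t / (1 - t) W(e)\<close> to the diagonal block of \<open>v\<close>. The kernel \<open>N\<close> obtained in
  this way has the inverse \<open>M\<^sub>u(v) - t (J \<otimes> W(e)\<^sup>-\<^sup>1)\<close>.
\<close>

lemma half_edge_bound:
  assumes uv: "{u, v} \<in> E" and t: "0 \<le> t" "t < 1"
    and r: "rho (split_bottleneck s vs E W u v t) \<le> r" "0 < r"
  shows "(\<Sum>p\<in>coords (branch V E u v). (y p)\<^sup>2) / r
    \<le> form (coords (branch V E u v)) L y y
      + t / (1 - t) * (\<Sum>i<s. \<Sum>j<s. y (v, i) * w u v i j * y (v, j))"
proof -
  let ?B = "branch V E u v" and ?S = "split_kernel u v t"
  note B = neighbour_branch[OF uv]
  have finB: "finite ?B" by (rule finite_subset[OF B(4)]) simp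
  define P where "P p q = (if fst p = v \<and> fst q = v then w u v (snd p) (snd q) else 0)" for p q
  define N where "N p q = L p q + t / (1 - t) * P p q" for p q
  have P_apply: "(\<Sum>q\<in>coords ?B. P p q * g q)
      = (if fst p = v then \<Sum>j<s. w u v (snd p) j * g (v, j) else 0)" for p g
  proof -
    have "(\<Sum>q\<in>coords ?B. P p q * g q)
        = (\<Sum>x\<in>?B. if x = v then if fst p = v then \<Sum>j<s. w u v (snd p) j * g (v, j) else 0 else 0)"
      unfolding sum_coords by (intro sum.cong refl) (simp add: P_def)
    then show ?thesis using B(3) finB by simp
  qed
  have P_form: "form (coords ?B) P g g = (\<Sum>i<s. \<Sum>j<s. g (v, i) * w u v i j * g (v, j))" for g
  proof -
    have "form (coords ?B) P g g
        = (\<Sum>x\<in>?B. if x = v then \<Sum>i<s. \<Sum>j<s. g (v, i) * w u v i j * g (v, j) else 0)"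
      unfolding form_eq_sum_apply P_apply unfolding sum_coords
      by (intro sum.cong refl) (simp add: sum_distrib_left mult.assoc)
    then show ?thesis using B(3) finB by simp
  qed
  have N_form: "form (coords ?B) N g g = form (coords ?B) L g g
      + t / (1 - t) * (\<Sum>i<s. \<Sum>j<s. g (v, i) * w u v i j * g (v, j))" for g
    using form_diff_scaled_kernel[of "coords ?B" L "- (t / (1 - t))" P g g]
    unfolding P_form by (simp add: N_def[abs_def])
  have "(\<Sum>p\<in>coords ?B. (y p)\<^sup>2) / r \<le> form (coords ?B) N y y"
  proof (rule form_ge_of_inverse[where S = ?S])
    show "finite (coords ?B)" using finB by simp
    show "N p q = N q p" if "p \<in> coords ?B" "q \<in> coords ?B" for p q
    proof -
      have "L p q = L q p" using that B(4) by (intro L_sym) auto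
      moreover have "P p q = P q p" using that w_sym[of "snd p" "snd q" u v] by (auto simp: P_def)
      ultimately show ?thesis by (simp add: N_def)
    qed
    show "(\<Sum>q\<in>coords ?B. N p q * ?S q z) = (if p = z then 1 else 0)"
      if p: "p \<in> coords ?B" and z: "z \<in> coords ?B" for p z
    proof -
      have "(\<Sum>q\<in>coords ?B. N p q * ?S q z) = (\<Sum>q\<in>coords ?B. L p q * ?S q z)
          + t / (1 - t) * (\<Sum>q\<in>coords ?B. P p q * ?S q z)"
        by (simp only: N_def distrib_right sum.distrib sum_distrib_left mult.assoc)
      also have "(\<Sum>q\<in>coords ?B. P p q * ?S q z)
          = (if fst p = v then \<Sum>j<s. w u v (snd p) j * ?S (v, j) z else 0)"
        by (rule P_apply)
      also have "(\<Sum>j<s. w u v (snd p) j * ?S (v, j) z) = (1 - t) * (\<Sum>j<s. w u v (snd p) j * winv {u, v} j (snd z))"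
        using split_kernel_at_neighbour[OF uv z]
        by (simp add: sum_distrib_left mult.left_commute)
      also have "(\<Sum>j<s. w u v (snd p) j * winv {u, v} j (snd z)) = (if snd p = snd z then 1 else 0)"
        using p z by (intro w_winv[OF uv]) auto
      finally show ?thesis
        using t unfolding L_split_kernel[OF uv p z] by auto
    qed
    show "0 \<le> form (coords ?B) N f f" for f
      unfolding N_form using t
      by (intro add_nonneg_nonneg mult_nonneg_nonneg form_L_part_nonneg[OF B(4)]
          weight_form_nonneg[of "\<lambda>i. f (v, i)"]) auto
    have "form (coords ?B) ?S y y \<le> rho (split_bottleneck s vs E W u v t) * (\<Sum>p\<in>coords ?B. (y p)\<^sup>2)"
      using abs_form_le_rho[where K = ?S and f = y, OF distinct_coord_list B(6)]
        split_kernel_sym[OF uv, of _ _ t]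
      unfolding B(5) split_bottleneck_kmat[OF uv] by (auto dest: abs_le_D1)
    also have "\<dots> \<le> r * (\<Sum>p\<in>coords ?B. (y p)\<^sup>2)"
      using r by (intro mult_right_mono sum_nonneg) auto
    finally show "form (coords ?B) ?S y y \<le> r * (\<Sum>p\<in>coords ?B. (y p)\<^sup>2)" .
    show "0 < r" by (rule r)
  qed
  then show ?thesis unfolding N_form .
qed

text \<open>
  The only nonzero block of the Laplacian between the two sides of the edge is \<open>- W(e)\<close>.
\<close>

lemma form_L_across_edge:
  assumes uv: "{u, v} \<in> E"
  shows "form (coords V) L y y = form (coords (branch V E u v)) L y y + form (coords (branch V E v u)) L y y
    - 2 * (\<Sum>i<s. \<Sum>j<s. y (v, i) * w u v i j * y (u, j))"
proof -
  let ?B = "branch V E u v" and ?C = "branch V E v u"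
  have vu: "{v, u} \<in> E" using uv by (simp add: insert_commute)
  note B = neighbour_branch[OF uv] and C = neighbour_branch[OF vu]
  have C_eq: "?C = V - ?B" by (rule edge_splits_tree[OF tree uv])
  have fin: "finite ?B" "finite ?C" using finite_subset[OF B(4)] finite_subset[OF C(4)] by auto
  have Lw: "L (x, i) (z, j) = (if x = v \<and> z = u then - w u v i j else 0)"
    if xz: "x \<in> ?B" "z \<in> ?C" and ij: "i < s" "j < s" for x z i j
  proof -
    have "x \<noteq> z" "z \<notin> ?B" using xz C_eq by auto
    then show ?thesis
      using L_offdiag[OF \<open>x \<noteq> z\<close> ij] w_out_of_branch[OF uv xz(1), of z i j] w_flip[of v u] by auto
  qed
  have "(\<Sum>p\<in>coords ?B. \<Sum>q\<in>coords ?C. y p * L p q * y q)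
      = (\<Sum>x\<in>?B. if x = v then \<Sum>i<s. \<Sum>z\<in>?C. if z = u then \<Sum>j<s. - (y (v, i) * w u v i j * y (u, j)) else 0 else 0)"
    unfolding sum_coords by (intro sum.cong refl) (auto simp: Lw intro!: sum.cong)
  also have "\<dots> = - (\<Sum>i<s. \<Sum>j<s. y (v, i) * w u v i j * y (u, j))"
    using B(3) C(3) fin by (simp add: sum_negf)
  finally have cross: "(\<Sum>p\<in>coords ?B. \<Sum>q\<in>coords ?C. y p * L p q * y q)
      = - (\<Sum>i<s. \<Sum>j<s. y (v, i) * w u v i j * y (u, j))" .
  have "coords V = coords ?B \<union> coords ?C" using B(4) C_eq by blast
  moreover have "form (coords ?B \<union> coords ?C) L y y = form (coords ?B) L y y + form (coords ?C) L y y
      + 2 * (\<Sum>p\<in>coords ?B. \<Sum>q\<in>coords ?C. y p * L p q * y q)"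
  proof (rule form_Un_disjoint)
    show "L p q = L q p" if "p \<in> coords ?B" "q \<in> coords ?C" for p q
      using that B(4) C(4) by (intro L_sym) auto
  qed (use fin C_eq in auto)
  ultimately show ?thesis unfolding cross by simp
qed

text \<open>
  With \<open>d = f\<^sub>v - f\<^sub>u\<close> the shifted vector has the values \<open>(1 - t) d\<close> at \<open>v\<close> and \<open>- t d\<close> at \<open>u\<close>. The
  two additional diagonal terms of the halves are then equal to \<open>t (1 - t) (d \<cdot> W(e) d)\<close> each, and
  their sum is exactly the cross term of the edge.
\<close>

lemma edge_bound:
  assumes uv: "{u, v} \<in> E" and t: "0 < t" "t < 1"
    and eq: "rho (split_bottleneck s vs E W u v t) = rho (split_bottleneck s vs E W v u (1 - t))"
  shows "1 / rho (split_bottleneck s vs E W u v t) \<le> mu s vs E W"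
proof (rule le_mu_if_energy_bound)
  let ?B = "branch V E u v" and ?C = "branch V E v u"
  let ?r = "rho (split_bottleneck s vs E W u v t)"
  have vu: "{v, u} \<in> E" using uv by (simp add: insert_commute)
  note B = neighbour_branch[OF uv] and C = neighbour_branch[OF vu]
  have r0: "0 \<le> ?r"
    unfolding split_bottleneck_kmat[OF uv] using B(6) by (intro rho_nonneg[OF kmat_carrier]) auto
  then show "0 \<le> 1 / ?r" by simp
  fix f :: "'a \<times> nat \<Rightarrow> real"
  define c where "c i = (1 - t) * f (u, i) + t * f (v, i)" for i
  define y where "y p = f p - c (snd p)" for p
  define d where "d i = f (v, i) - f (u, i)" for i
  define q where "q = (\<Sum>i<s. \<Sum>j<s. d i * w u v i j * d j)"
  have scale: "(\<Sum>i<s. \<Sum>j<s. (a * d i) * w u v i j * (b * d j)) = a * b * q" for a b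
    unfolding q_def sum_distrib_left by (intro sum.cong refl) (simp add: mult_ac)
  have yv: "y (v, i) = (1 - t) * d i" and yu: "y (u, i) = (- t) * d i" for i
    by (simp_all add: y_def c_def d_def algebra_simps)
  show "\<exists>c. 1 / ?r * (\<Sum>p\<in>coords V. (f p - c (snd p))\<^sup>2) \<le> form (coords V) L f f"
  proof (cases "?r = 0")
    case True
    then show ?thesis using form_L_nonneg by simp
  next
    case False
    then have r: "0 < ?r" using r0 by simp
    have 1: "(\<Sum>p\<in>coords ?B. (y p)\<^sup>2) / ?r \<le> form (coords ?B) L y y + t / (1 - t) * ((1 - t) * (1 - t) * q)"
      using half_edge_bound[OF uv _ t(2) order_refl r, of y] t(1) unfolding yv scale by simp
    have 2: "(\<Sum>p\<in>coords ?C. (y p)\<^sup>2) / ?r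
        \<le> form (coords ?C) L y y + (1 - t) / (1 - (1 - t)) * ((- t) * (- t) * q)"
      using half_edge_bound[OF vu _ _ eq_refl[OF eq[symmetric]] r, of y] t
      unfolding yu w_flip[of v u] scale by simp
    have 3: "form (coords V) L y y = form (coords ?B) L y y + form (coords ?C) L y y - 2 * ((1 - t) * (- t) * q)"
      using form_L_across_edge[OF uv, of y] unfolding yv yu scale .
    have "coords V = coords ?B \<union> coords ?C" and "coords ?B \<inter> coords ?C = {}"
      using B(4) edge_splits_tree[OF tree uv] by auto
    moreover have "finite (coords ?B)" "finite (coords ?C)"
      using finite_subset[OF B(4)] finite_subset[OF C(4)] by auto
    ultimately have "(\<Sum>p\<in>coords V. (y p)\<^sup>2) / ?r
        = (\<Sum>p\<in>coords ?B. (y p)\<^sup>2) / ?r + (\<Sum>p\<in>coords ?C. (y p)\<^sup>2) / ?r"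
      by (simp add: sum.union_disjoint add_divide_distrib)
    also have "\<dots> \<le> form (coords V) L y y"
    proof -
      have "t / (1 - t) * ((1 - t) * (1 - t) * q) = t * (1 - t) * q"
        "(1 - t) / (1 - (1 - t)) * ((- t) * (- t) * q) = t * (1 - t) * q"
        using t by simp_all
      then show ?thesis using 1 2 unfolding 3 by (simp add: algebra_simps)
    qed
    also have "\<dots> = form (coords V) L f f" unfolding y_def by (rule form_L_shift)
    finally show ?thesis unfolding y_def by (intro exI[of _ c]) simp
  qed
qed

section \<open>Existence of the edge and of the splitting parameter\<close>

text \<open>
  For \<open>t = 1\<close> the whole resistance of \<open>e\<close> is taken away, which grounds the branch at \<open>v\<close> itself. What
  remains is a part of \<open>M\<^sub>v\<close>, with zero blocks in the row and column of \<open>v\<close>.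
\<close>

lemma form_split_kernel_1:
  assumes uv: "{u, v} \<in> E"
  shows "form (coords (branch V E u v)) (split_kernel u v 1) f f
    = form (coords (V - {v})) (green v)
        (\<lambda>p. if p \<in> coords (branch V E u v) then f p else 0)
        (\<lambda>p. if p \<in> coords (branch V E u v) then f p else 0)"
proof -
  let ?B = "branch V E u v" and ?S = "split_kernel u v 1"
  let ?X = "coords (branch V E u v)" and ?Y = "coords (V - {v})"
  let ?f = "\<lambda>p. if p \<in> ?X then f p else 0"
  note B = neighbour_branch[OF uv] and e = edgeD[OF uv]
  have finX: "finite ?X" using finite_subset[OF B(4)] by simp
  \<comment> \<open>The solution of \<open>L\<^sub>v g = ?f\<close>; it vanishes at \<open>v\<close> because the row of \<open>?S\<close> at \<open>v\<close> does.\<close>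
  define g where "g p = (if p \<in> ?X then \<Sum>r\<in>?X. ?S p r * f r else 0)" for p
  have gv: "g p = 0" if "p \<notin> ?X \<inter> ?Y" "p \<in> ?X \<union> ?Y" for p
  proof (cases "p \<in> ?X")
    case True
    then have "fst p = v" "snd p < s" using that B(4) by auto
    then have "?S p r = 0" if "r \<in> ?X" for r
      using split_kernel_at_neighbour[OF uv that, of "snd p" 1] by (metis diff_self mult_zero_left prod.collapse)
    then show ?thesis by (simp add: g_def)
  qed (simp add: g_def)
  have Lg: "(\<Sum>q\<in>?Y. L p q * g q) = ?f p" if p: "p \<in> ?Y" for p
  proof (cases "p \<in> ?X")
    case True
    have "(\<Sum>q\<in>?Y. L p q * g q) = (\<Sum>q\<in>?X \<inter> ?Y. L p q * g q)"
      using gv by (intro sum.mono_neutral_right) auto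
    also have "\<dots> = (\<Sum>q\<in>?X. L p q * g q)"
      using gv finX by (intro sum.mono_neutral_left) auto
    also have "\<dots> = (\<Sum>q\<in>?X. \<Sum>r\<in>?X. L p q * ?S q r * f r)"
      by (intro sum.cong refl) (simp only: g_def if_True sum_distrib_left mult.assoc)
    also have "\<dots> = (\<Sum>r\<in>?X. (\<Sum>q\<in>?X. L p q * ?S q r) * f r)"
      by (subst sum.swap) (simp only: sum_distrib_right)
    also have "\<dots> = (\<Sum>r\<in>?X. if p = r then f r else 0)"
    proof (intro sum.cong refl)
      fix r assume "r \<in> ?X"
      moreover have "fst p \<noteq> v" using p by auto
      ultimately show "(\<Sum>q\<in>?X. L p q * ?S q r) * f r = (if p = r then f r else 0)"
        using L_split_kernel[OF uv True, of r 1] by simp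
    qed
    also have "\<dots> = f p" using finX True by simp
    finally show ?thesis using True by simp
  next
    case False
    have "L p q * g q = 0" if q: "q \<in> ?Y" for q
    proof (cases "q \<in> ?X")
      case True
      have "fst q \<in> ?B" "fst p \<notin> ?B" "fst q \<noteq> v" "snd p < s" "snd q < s"
        using True False p q by auto
      then have "{fst q, fst p} \<notin> E" "fst p \<noteq> fst q"
        using edge_leaving_branch[OF tree uv, of "fst q" "fst p"] by auto
      then show ?thesis
        using L_no_edge[of p q] \<open>snd p < s\<close> \<open>snd q < s\<close> by (simp add: insert_commute)
    qed (simp add: g_def)
    then have "(\<Sum>q\<in>?Y. L p q * g q) = 0" by (intro sum.neutral ballI)
    then show ?thesis using False by simp
  qed
  have Gf: "(\<Sum>q\<in>?Y. green v p q * ?f q) = g p" if p: "p \<in> ?Y" for p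
  proof -
    have "(\<Sum>q\<in>?Y. green v p q * ?f q) = (\<Sum>q\<in>?Y. green v p q * (\<Sum>r\<in>?Y. L q r * g r))"
      by (intro sum.cong refl) (simp only: Lg)
    also have "\<dots> = (\<Sum>q\<in>?Y. \<Sum>r\<in>?Y. green v p q * L q r * g r)"
      by (simp only: sum_distrib_left mult.assoc)
    also have "\<dots> = (\<Sum>r\<in>?Y. (\<Sum>q\<in>?Y. green v p q * L q r) * g r)"
      by (subst sum.swap) (simp only: sum_distrib_right)
    also have "\<dots> = (\<Sum>r\<in>?Y. if p = r then g r else 0)"
    proof (intro sum.cong refl)
      fix r assume "r \<in> ?Y"
      then show "(\<Sum>q\<in>?Y. green v p q * L q r) * g r = (if p = r then g r else 0)"
        using green_L[OF e(2) p, of r] by simp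
    qed
    also have "\<dots> = g p" using p by simp
    finally show ?thesis .
  qed
  have "form ?Y (green v) ?f ?f = (\<Sum>p\<in>?Y. ?f p * g p)"
    unfolding form_eq_sum_apply by (intro sum.cong refl) (simp only: Gf)
  also have "\<dots> = (\<Sum>p\<in>?X \<inter> ?Y. f p * g p)"
    by (intro sum.mono_neutral_cong_right) auto
  also have "\<dots> = (\<Sum>p\<in>?X. f p * g p)"
    using gv finX by (intro sum.mono_neutral_left) auto
  also have "\<dots> = form ?X ?S f f"
    unfolding form_eq_sum_apply by (intro sum.cong refl) (simp only: g_def if_True)
  finally show ?thesis ..
qed

text \<open>
  A maximiser of the absolute Rayleigh quotient on the left is, after restriction, a vector on the
  branches at \<open>v\<close> other than the one of \<open>u\<close>. If it reached \<open>\<rho>(M\<^sub>v)\<close>, one of these branches would be a Perron branch.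
\<close>

lemma rho_split_1_less:
  assumes uv: "{u, v} \<in> E"
    and unique: "\<And>D. perron_branch s vs E W v D \<Longrightarrow> D = branch V E v u"
  shows "rho (split_bottleneck s vs E W u v 1) < rho (M_mat s vs E W v)"
proof (rule ccontr)
  let ?B = "branch V E u v"
  let ?r = "rho (split_bottleneck s vs E W u v 1)" and ?R = "rho (M_mat s vs E W v)"
  assume "\<not> ?thesis"
  then have rR: "?R \<le> ?r" by simp
  note B = neighbour_branch[OF uv] and e = edgeD[OF uv]
  have sym: "split_kernel u v 1 p q = split_kernel u v 1 q p"
    if "p \<in> set (coord_list ?B)" "q \<in> set (coord_list ?B)" for p q
    using that split_kernel_sym[OF uv, of p q 1] unfolding B(5) by simp
  obtain f where f: "0 < (\<Sum>p\<in>set (coord_list ?B). (f p)\<^sup>2)"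
    "\<bar>form (set (coord_list ?B)) (split_kernel u v 1) f f\<bar>
      = rho (kmat (coord_list ?B) (split_kernel u v 1)) * (\<Sum>p\<in>set (coord_list ?B). (f p)\<^sup>2)"
    by (rule rho_attained[where K = "split_kernel u v 1", OF distinct_coord_list B(6) sym])
  define N where "N = (\<Sum>p\<in>coords ?B. (f p)\<^sup>2)"
  define g where "g p = (if p \<in> coords ?B then f p else 0)" for p
  define N' where "N' = (\<Sum>p\<in>coords (V - {v}). (g p)\<^sup>2)"
  have N: "0 < N" and form: "\<bar>form (coords (V - {v})) (green v) g g\<bar> = ?r * N"
    using f form_split_kernel_1[OF uv, of f]
    unfolding B(5) N_def g_def split_bottleneck_kmat[OF uv] by simp_all
  have finB: "finite (coords ?B)" using finite_subset[OF B(4)] by simp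
  have "N' = (\<Sum>p\<in>coords ?B \<inter> coords (V - {v}). (f p)\<^sup>2)"
    unfolding N'_def g_def by (intro sum.mono_neutral_cong_right) auto
  also have "\<dots> \<le> N" unfolding N_def using finB by (intro sum_mono2) auto
  finally have N'N: "N' \<le> N" .
  have R: "0 < ?R" by (rule rho_M_mat_pos[OF e(2)])
  have big: "?R * N' \<le> \<bar>form (coords (V - {v})) (green v) g g\<bar>"
    unfolding form using R rR N'N N by (intro mult_mono) (auto simp: N'_def sum_nonneg)
  have "0 < N'"
  proof (rule ccontr)
    assume "\<not> 0 < N'"
    then have "?R * N' \<le> 0" using R by (simp add: mult_le_0_iff)
    moreover have "?r * N \<le> ?R * N'"
      using form_green_le[OF e(2), of g] unfolding form N'_def .
    moreover have "0 < ?r * N" using R rR N by simp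
    ultimately show False by linarith
  qed
  then obtain D p where "perron_branch s vs E W v D" "p \<in> coords D" "g p \<noteq> 0"
    using perron_branch_in_support[OF e(2), of g] big unfolding N'_def by blast
  then show False
    using unique edge_splits_tree[OF tree uv] by (auto simp: g_def split: if_splits)
qed

lemma isCont_rho_split:
  assumes uv: "{u, v} \<in> E"
  shows "isCont (\<lambda>t. rho (split_bottleneck s vs E W u v t)) t"
proof -
  let ?ps = "coord_list (branch V E u v)"
  note B = neighbour_branch[OF uv]
  have 1: "green u p q = green u q p" if "p \<in> set ?ps" "q \<in> set ?ps" for p q
    using sym_green_list[OF edgeD(1)[OF uv] B(2) that] .
  have 2: "winv {u, v} (snd p) (snd q) = winv {u, v} (snd q) (snd p)"
    if "p \<in> set ?ps" "q \<in> set ?ps" for p q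
    using that unfolding B(5) by (intro winv_sym[OF uv]) auto
  have "isCont (\<lambda>t. rho (kmat ?ps (\<lambda>p q. green u p q - t * winv {u, v} (snd p) (snd q)))) t"
    by (rule isCont_rho_pencil[where K = "green u" and G = "\<lambda>p q. winv {u, v} (snd p) (snd q)",
          OF distinct_coord_list B(6) 1 2])
  then show ?thesis
    unfolding split_bottleneck_kmat[OF uv] split_kernel_def[abs_def] .
qed

lemma rho_split_0:
  assumes uv: "{u, v} \<in> E" and P: "perron_branch s vs E W u (branch V E u v)"
  shows "rho (split_bottleneck s vs E W u v 0) = rho (M_mat s vs E W u)"
proof -
  note B = neighbour_branch[OF uv]
  have "split_kernel u v 0 = green u" by (intro ext) (simp add: split_kernel_def)
  then have "split_bottleneck s vs E W u v 0 = bottleneck s vs E W u (branch V E u v)"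
    using bottleneck_kmat[OF edgeD(1)[OF uv] B(2)] split_bottleneck_kmat[OF uv, of 0] by simp
  then show ?thesis using P by (simp add: perron_branch_def)
qed

lemma splitting_parameter_exists:
  assumes uv: "char_like_edge s vs E W u v"
  obtains t where "0 < t" "t < 1"
    "rho (split_bottleneck s vs E W u v t) = rho (split_bottleneck s vs E W v u (1 - t))"
proof -
  have e: "{u, v} \<in> E" and e': "{v, u} \<in> E"
    and Pu: "perron_branch s vs E W u D \<longleftrightarrow> D = branch V E u v"
    and Pv: "perron_branch s vs E W v D \<longleftrightarrow> D = branch V E v u" for D
    using uv by (auto simp: char_like_edge_def insert_commute)
  let ?g = "\<lambda>t. rho (split_bottleneck s vs E W u v t)"
  let ?h = "\<lambda>t. rho (split_bottleneck s vs E W v u t)"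
  let ?F = "\<lambda>t. ?g t - ?h (1 - t)"
  have F0: "0 < ?F 0"
    using rho_split_0[OF e] rho_split_1_less[OF e'] Pu by simp
  have F1: "?F 1 < 0"
    using rho_split_0[OF e'] rho_split_1_less[OF e] Pv by simp
  have "isCont (\<lambda>t. ?h (1 - t)) t" for t
    by (rule isCont_o2[where g = ?h and f = "\<lambda>t. 1 - t", OF _ isCont_rho_split[OF e']]) simp
  then have "isCont ?F t" for t
    by (intro isCont_diff isCont_rho_split[OF e])
  then obtain t where t: "0 \<le> t" "t \<le> 1" "?F t = 0"
    using IVT2[of ?F 1 0 0] F0 F1 by auto
  then have "t \<noteq> 0" "t \<noteq> 1" using F0 F1 by auto
  then show thesis using t by (intro that[of t]) auto
qed

lemma char_like_edge_exists:
  assumes no: "\<not> (\<exists>v. char_like_vertex s vs E W v)"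
  obtains u v where "char_like_edge s vs E W u v"
proof -
  have unique: "B = C" if "v \<in> V" "perron_branch s vs E W v B" "perron_branch s vs E W v C" for v B C
    using no that by (auto simp: char_like_vertex_def)
  define P where "P v = (SOME D. perron_branch s vs E W v D)" for v
  have P: "perron_branch s vs E W v (P v)" if "v \<in> V" for v
    using perron_branch_exists[OF that] unfolding P_def by (metis someI)
  have "P v \<in> branches V E v" if "v \<in> V" for v
    using P[OF that] by (simp add: perron_branch_def)
  then obtain u v where uv: "{u, v} \<in> E" "P u = branch V E u v" "P v = branch V E v u"
    by (rule neighbouring_branches_point_at_each_other[OF tree V_ne])
  have "{B. perron_branch s vs E W x B} = {P x}" if "x \<in> V" for x
    using P[OF that] unique[OF that] by blast
  then have "char_like_edge s vs E W u v"
    using uv edgeD[OF uv(1)] by (simp add: char_like_edge_def)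
  then show thesis by (rule that)
qed

section \<open>The bound for \<open>\<kappa>\<close>\<close>

lemma kappa_le_mu: "kappa s vs E W \<le> mu s vs E W"
proof (cases "\<exists>v. char_like_vertex s vs E W v")
  case True
  then have "char_like_vertex s vs E W (SOME v. char_like_vertex s vs E W v)" by (rule someI_ex)
  then have "(SOME v. char_like_vertex s vs E W v) \<in> V" by (simp add: char_like_vertex_def)
  from vertex_bound[OF this] show ?thesis using True by (simp add: kappa_def)
next
  case False
  let ?P = "\<lambda>(u, v, t). char_like_edge s vs E W u v \<and> 0 < t \<and> t < 1 \<and>
    rho (split_bottleneck s vs E W u v t) = rho (split_bottleneck s vs E W v u (1 - t))"
  obtain u v where uv: "char_like_edge s vs E W u v" using char_like_edge_exists[OF False] .
  obtain t where "0 < t" "t < 1"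
    "rho (split_bottleneck s vs E W u v t) = rho (split_bottleneck s vs E W v u (1 - t))"
    using splitting_parameter_exists[OF uv] .
  with uv have "?P (u, v, t)" by simp
  then have "?P (SOME x. ?P x)" by (rule someI)
  moreover obtain u' v' t' where eq: "(SOME x. ?P x) = (u', v', t')" by (rule prod_cases3)
  ultimately have P: "?P (u', v', t')" by simp
  then have "1 / rho (split_bottleneck s vs E W u' v' t') \<le> mu s vs E W"
    using edge_bound[of u' v' t'] by (simp add: char_like_edge_def)
  then show ?thesis using False by (simp add: kappa_def eq)
qed

end

theorem theorem4p6:
  fixes V :: "'a set" and vs :: "'a list" and E :: "'a set set"
    and W :: "'a set \<Rightarrow> real mat" and s :: nat
  assumes "tree V E" and "2 \<le> card V"
    and "distinct vs" and "set vs = V"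
    and "0 < s"
    and "\<And>e. e \<in> E \<Longrightarrow> sym_pos_def s (W e)"
  shows "kappa s vs E W \<le> mu s vs E W"
proof -
  interpret weighted_tree vs E W s
    using assms by unfold_locales auto
  show ?thesis by (rule kappa_le_mu)
qed

end
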